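(* Let $(M,P,g)$ be a $\mathcal{W}_1$-manifold with $\dim M=2n$, and let $R'$ be the curvature tensor of the natural connection $\nabla'$ on it determined by the pair of real parameters $(\lambda,\mu)$. Then all possible cases are as follows: (i) If $\nabla'$ is the connection $D$ determined by $\lambda=\mu=0$, then $R'$ is a Riemannian $P$-tensor if and only if the 1-form $\theta$ is not closed and the 1-form $\theta\circ P$ is closed. (ii) If $\nabla'$ is the connection $\widetilde D$ determined by $\lambda=0$, $\mu=-\frac1{2n}$, then $R'$ is a Riemannian $P$-tensor if and only if the 1-form $\theta$ is closed and the 1-form $\theta\circ P$ is not closed. (iii) If $\nabla'$ is a connection for which $\lambda^2-\mu^2-\frac{\mu}{2n}\neq0$, then $R'$ is a Riemannian $P$-tensor if and only if the 1-forms $\theta$ and $\theta\circ P$ are closed. (iv) If $\nabla'$ is a connection for which $\lambda\neq0$, $\lambda^2-\mu^2-\frac{\mu}{2n}=0$ and $R'$ is a Riemannian $P$-tensor, then the 1-forms $\theta$ and $\theta\circ P$ are not closed. In this case $(M,P,g)\notin\overline{\mathcal{W}}_3$ and $(M,P,g)\notin\overline{\mathcal{W}}_6$.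
   Context: Setting. A Riemannian almost product manifold $(M,P,g)$ is a differentiable manifold $M$ with a $(1,1)$-tensor field $P$ and a Riemannian metric $g$ such that $P^2x=x$ and $g(Px,Py)=g(x,y)$. Throughout $\operatorname{tr}P=0$ and $\dim M=2n$; $x,y,z,w$ are arbitrary smooth vector fields (or tangent vectors). Let $\nabla$ be the Levi-Civita connection of $g$, $F(x,y,z)=g((\nabla_xP)y,z)$, and $\theta(x)=g^{ij}F(e_i,e_j,x)$, where $\{e_i\}$ is a basis of the tangent space and $(g^{ij})$ is the inverse matrix of $(g(e_i,e_j))$. $(M,P,g)$ is a $\mathcal{W}_1$-manifold if $$F(x,y,z)=\tfrac{1}{2n}\{g(x,y)\theta(z)-g(x,Py)\theta(Pz)+g(x,z)\theta(y)-g(x,Pz)\theta(Py)\}.$$ The vector field $\Omega$ is defined by $g(\Omega,x)=\theta(x)$. Subclasses of $\mathcal{W}_1$. $\overline{\mathcal{W}}_3$: $F(x,y,z)=\frac1{2n}\{[g(x,y)+g(x,Py)]\theta(z)+[g(x,z)+g(x,Pz)]\theta(y)\}$ and $\theta(Px)=-\theta(x)$. $\overline{\mathcal{W}}_6$: $F(x,y,z)=\frac1{2n}\{[g(x,y)-g(x,Py)]\theta(z)+[g(x,z)-g(x,Pz)]\theta(y)\}$ and $\theta(Px)=\theta(x)$. Natural connections. A linear connection $\nabla'$ is natural if $\nabla'P=\nabla'g=0$. The natural connections considered on a $\mathcal{W}_1$-manifold form a 2-parametric family with parameters $\lambda,\mu\in\mathbb{R}$; the one determined by $(\lambda,\mu)$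 is $$\nabla'_xy=\nabla_xy+g(x,Py)\{\lambda P\Omega+\mu\Omega\}-\{\lambda\theta(Py)+\mu\theta(y)\}Px+g(x,y)\{\lambda\Omega+(\mu+\tfrac1{2n})P\Omega\}-\{\lambda\theta(y)+(\mu+\tfrac1{2n})\theta(Py)\}x.$$ Curvature. $R'(x,y)z=\nabla'_x\nabla'_yz-\nabla'_y\nabla'_xz-\nabla'_{[x,y]}z$, $R'(x,y,z,w)=g(R'(x,y)z,w)$. A $(0,4)$-tensor $L$ is a Riemannian $P$-tensor if $L(x,y,z,w)=-L(y,x,z,w)=-L(x,y,w,z)$, $L(x,y,z,w)+L(y,z,x,w)+L(z,x,y,w)=0$, and $L(x,y,Pz,Pw)=L(x,y,z,w)$.
   Formalization: Assumes n ≥ 2 (for n = 1, R' = 0 always, so the claims fail) and, in (i), (ii) and (iv), that θ and θ∘P are not both closed (if both are, e.g. on flat Rⁿ×Rⁿ, R' is a Riemannian P-tensor for every λ, μ and these cases fail). *)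

theory Defs
  imports "HOL-Analysis.Analysis"
begin

subsection \<open>Smooth manifolds\<close>

primrec Ck_on :: "nat \<Rightarrow> 'a::real_normed_vector set \<Rightarrow> ('a \<Rightarrow> 'b::real_normed_vector) \<Rightarrow> bool" where
  "Ck_on 0 S f \<longleftrightarrow> continuous_on S f"
| "Ck_on (Suc k) S f \<longleftrightarrow>
     (\<forall>x\<in>S. f differentiable (at x)) \<and> (\<forall>v. Ck_on k S (\<lambda>x. frechet_derivative f (at x) v))"

definition Cinf_on :: "'a::real_normed_vector set \<Rightarrow> ('a \<Rightarrow> 'b::real_normed_vector) \<Rightarrow> bool" where
  "Cinf_on S f \<longleftrightarrow> (\<forall>k. Ck_on k S f)"

text \<open>A chart is a domain together with a coordinate map that is only meaningful on this domain.\<close>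

type_synonym ('m, 'n) chart = "'m set \<times> ('m \<Rightarrow> real ^ 'n)"

abbreviation dom_of :: "('m, 'n) chart \<Rightarrow> 'm set" where
  "dom_of c \<equiv> fst c"

abbreviation coord :: "('m, 'n) chart \<Rightarrow> 'm \<Rightarrow> real ^ 'n" where
  "coord c \<equiv> snd c"

definition param :: "('m, 'n) chart \<Rightarrow> real ^ 'n \<Rightarrow> 'm" where
  "param c = inv_into (dom_of c) (coord c)"

text \<open>The manifold is the whole (Hausdorff, second countable) type \<^typ>\<open>'m\<close>; it need not be
  connected.\<close>

definition smooth_atlas ::
    "('m::{t2_space,second_countable_topology}, 'n::finite) chart set \<Rightarrow> bool" where
  "smooth_atlas A \<longleftrightarrow>
     (\<Union>c\<in>A. dom_of c) = UNIV \<and>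
     (\<forall>c\<in>A. open (dom_of c) \<and> open (coord c ` dom_of c) \<and>
             homeomorphism (dom_of c) (coord c ` dom_of c) (coord c) (param c)) \<and>
     (\<forall>c\<in>A. \<forall>d\<in>A. Cinf_on (coord c ` (dom_of c \<inter> dom_of d)) (coord d \<circ> param c))"

subsection \<open>Tangent vectors, functions and vector fields\<close>

text \<open>A tangent vector at \<open>p\<close> is represented by its coordinates with respect to one fixed chart
  \<open>chart_at A p\<close> around \<open>p\<close>. So every tangent space is a copy of \<^typ>\<open>real ^ 'n\<close>, a vector field is
  a function \<^typ>\<open>'m \<Rightarrow> real ^ 'n\<close>, and the values of a field at different points in general refer to
  different charts: smoothness and derivatives always have to pass through \<open>vf_rep\<close>.\<close>

definition chart_at :: "('m, 'n) chart set \<Rightarrow> 'm \<Rightarrow> ('m, 'n) chart" where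
  "chart_at A p = (SOME c. c \<in> A \<and> p \<in> dom_of c)"

text \<open>Passage from coordinates with respect to \<open>c\<close> to coordinates with respect to \<open>d\<close> of a tangent
  vector at \<open>p\<close>.\<close>

definition coord_change ::
    "('m, 'n::finite) chart \<Rightarrow> ('m, 'n) chart \<Rightarrow> 'm \<Rightarrow> real ^ 'n \<Rightarrow> real ^ 'n" where
  "coord_change c d p v = frechet_derivative (coord d \<circ> param c) (at (coord c p)) v"

definition vf_rep ::
    "('m, 'n::finite) chart set \<Rightarrow> ('m, 'n) chart \<Rightarrow> ('m \<Rightarrow> real ^ 'n) \<Rightarrow> real ^ 'n \<Rightarrow> real ^ 'n" where
  "vf_rep A c X x = coord_change (chart_at A (param c x)) c (param c x) (X (param c x))"

definition smooth_fun :: "('m, 'n::finite) chart set \<Rightarrow> ('m \<Rightarrow> real) \<Rightarrow> bool" where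
  "smooth_fun A f \<longleftrightarrow> (\<forall>c\<in>A. Cinf_on (coord c ` dom_of c) (f \<circ> param c))"

definition smooth_vf :: "('m, 'n::finite) chart set \<Rightarrow> ('m \<Rightarrow> real ^ 'n) \<Rightarrow> bool" where
  "smooth_vf A X \<longleftrightarrow> (\<forall>c\<in>A. Cinf_on (coord c ` dom_of c) (vf_rep A c X))"

text \<open>The derivative \<open>X f\<close> of a function along a vector field, and the Lie bracket
  \<open>[X, Y] = DY(X) - DX(Y)\<close>, both computed at \<open>p\<close> in the chart \<open>chart_at A p\<close>.\<close>

definition vf_deriv ::
    "('m, 'n::finite) chart set \<Rightarrow> ('m \<Rightarrow> real ^ 'n) \<Rightarrow> ('m \<Rightarrow> real) \<Rightarrow> 'm \<Rightarrow> real" where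
  "vf_deriv A X f p =
     frechet_derivative (f \<circ> param (chart_at A p)) (at (coord (chart_at A p) p)) (X p)"

definition bracket ::
    "('m, 'n::finite) chart set \<Rightarrow> ('m \<Rightarrow> real ^ 'n) \<Rightarrow> ('m \<Rightarrow> real ^ 'n) \<Rightarrow> 'm \<Rightarrow> real ^ 'n" where
  "bracket A X Y p =
     frechet_derivative (vf_rep A (chart_at A p) Y) (at (coord (chart_at A p) p)) (X p)
   - frechet_derivative (vf_rep A (chart_at A p) X) (at (coord (chart_at A p) p)) (Y p)"

subsection \<open>Riemannian almost product structures and connections\<close>

definition riemannian_metric ::
    "('m, 'n::finite) chart set \<Rightarrow> ('m \<Rightarrow> real ^ 'n \<Rightarrow> real ^ 'n \<Rightarrow> real) \<Rightarrow> bool" where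
  "riemannian_metric A g \<longleftrightarrow>
     (\<forall>p. bilinear (g p)) \<and>
     (\<forall>p u v. g p u v = g p v u) \<and>
     (\<forall>p u. u \<noteq> 0 \<longrightarrow> g p u u > 0) \<and>
     (\<forall>X Y. smooth_vf A X \<longrightarrow> smooth_vf A Y \<longrightarrow> smooth_fun A (\<lambda>p. g p (X p) (Y p)))"

definition tensor11 ::
    "('m, 'n::finite) chart set \<Rightarrow> ('m \<Rightarrow> real ^ 'n \<Rightarrow> real ^ 'n) \<Rightarrow> bool" where
  "tensor11 A P \<longleftrightarrow>
     (\<forall>p. linear (P p)) \<and> (\<forall>X. smooth_vf A X \<longrightarrow> smooth_vf A (\<lambda>p. P p (X p)))"

definition riemannian_almost_product ::
    "('m::{t2_space,second_countable_topology}, 'n::finite) chart set \<Rightarrow>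
     ('m \<Rightarrow> real ^ 'n \<Rightarrow> real ^ 'n) \<Rightarrow> ('m \<Rightarrow> real ^ 'n \<Rightarrow> real ^ 'n \<Rightarrow> real) \<Rightarrow> bool" where
  "riemannian_almost_product A P g \<longleftrightarrow>
     smooth_atlas A \<and> tensor11 A P \<and> riemannian_metric A g \<and>
     (\<forall>p u. P p (P p u) = u) \<and>
     (\<forall>p u v. g p (P p u) (P p v) = g p u v) \<and>
     (\<forall>p. trace (matrix (P p)) = 0)"

text \<open>A connection is an operator on vector fields; only its values on smooth fields matter.\<close>

type_synonym ('m, 'n) connection = "('m \<Rightarrow> real ^ 'n) \<Rightarrow> ('m \<Rightarrow> real ^ 'n) \<Rightarrow> 'm \<Rightarrow> real ^ 'n"

definition linear_connection ::
    "('m, 'n::finite) chart set \<Rightarrow> ('m, 'n) connection \<Rightarrow> bool" where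
  "linear_connection A D \<longleftrightarrow>
     (\<forall>X Y. smooth_vf A X \<longrightarrow> smooth_vf A Y \<longrightarrow> smooth_vf A (D X Y)) \<and>
     (\<forall>X Y Z. smooth_vf A X \<longrightarrow> smooth_vf A Y \<longrightarrow> smooth_vf A Z \<longrightarrow>
        D (\<lambda>p. X p + Y p) Z = (\<lambda>p. D X Z p + D Y Z p) \<and>
        D X (\<lambda>p. Y p + Z p) = (\<lambda>p. D X Y p + D X Z p)) \<and>
     (\<forall>f X Y. smooth_fun A f \<longrightarrow> smooth_vf A X \<longrightarrow> smooth_vf A Y \<longrightarrow>
        D (\<lambda>p. f p *\<^sub>R X p) Y = (\<lambda>p. f p *\<^sub>R D X Y p) \<and>
        D X (\<lambda>p. f p *\<^sub>R Y p) = (\<lambda>p. vf_deriv A X f p *\<^sub>R Y p + f p *\<^sub>R D X Y p))"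

definition levi_civita ::
    "('m, 'n::finite) chart set \<Rightarrow> ('m \<Rightarrow> real ^ 'n \<Rightarrow> real ^ 'n \<Rightarrow> real) \<Rightarrow>
     ('m, 'n) connection \<Rightarrow> bool" where
  "levi_civita A g D \<longleftrightarrow>
     linear_connection A D \<and>
     (\<forall>X Y p. smooth_vf A X \<longrightarrow> smooth_vf A Y \<longrightarrow> D X Y p - D Y X p = bracket A X Y p) \<and>
     (\<forall>X Y Z p. smooth_vf A X \<longrightarrow> smooth_vf A Y \<longrightarrow> smooth_vf A Z \<longrightarrow>
        vf_deriv A X (\<lambda>q. g q (Y q) (Z q)) p = g p (D X Y p) (Z p) + g p (Y p) (D X Z p))"

subsection \<open>The tensor \<open>F\<close>, the Lee form and the classes of manifolds\<close>

definition F_tensor ::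
    "('m \<Rightarrow> real ^ 'n \<Rightarrow> real ^ 'n) \<Rightarrow> ('m \<Rightarrow> real ^ 'n \<Rightarrow> real ^ 'n \<Rightarrow> real) \<Rightarrow>
     ('m, 'n::finite) connection \<Rightarrow>
     ('m \<Rightarrow> real ^ 'n) \<Rightarrow> ('m \<Rightarrow> real ^ 'n) \<Rightarrow> ('m \<Rightarrow> real ^ 'n) \<Rightarrow> 'm \<Rightarrow> real" where
  "F_tensor P g D X Y Z p = g p (D X (\<lambda>q. P q (Y q)) p - P p (D X Y p)) (Z p)"

text \<open>To evaluate the tensor \<open>F\<close> on tangent vectors at \<open>p\<close> these are extended to smooth vector
  fields; the value does not depend on the extension.\<close>

definition vf_extension :: "('m, 'n::finite) chart set \<Rightarrow> 'm \<Rightarrow> real ^ 'n \<Rightarrow> 'm \<Rightarrow> real ^ 'n" where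
  "vf_extension A p v = (SOME X. smooth_vf A X \<and> X p = v)"

definition F_at ::
    "('m, 'n::finite) chart set \<Rightarrow> ('m \<Rightarrow> real ^ 'n \<Rightarrow> real ^ 'n) \<Rightarrow>
     ('m \<Rightarrow> real ^ 'n \<Rightarrow> real ^ 'n \<Rightarrow> real) \<Rightarrow> ('m, 'n) connection \<Rightarrow>
     'm \<Rightarrow> real ^ 'n \<Rightarrow> real ^ 'n \<Rightarrow> real ^ 'n \<Rightarrow> real" where
  "F_at A P g D p u v w =
     F_tensor P g D (vf_extension A p u) (vf_extension A p v) (vf_extension A p w) p"

text \<open>\<open>\<theta>(v) = g\<^sup>i\<^sup>j F(e\<^sub>i, e\<^sub>j, v)\<close> for the standard basis \<open>e\<^sub>i = axis i 1\<close>, that is, for the coordinate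
  basis of \<open>chart_at A p\<close>; the trace does not depend on the basis.\<close>

definition lee_form ::
    "('m, 'n::finite) chart set \<Rightarrow> ('m \<Rightarrow> real ^ 'n \<Rightarrow> real ^ 'n) \<Rightarrow>
     ('m \<Rightarrow> real ^ 'n \<Rightarrow> real ^ 'n \<Rightarrow> real) \<Rightarrow> ('m, 'n) connection \<Rightarrow> 'm \<Rightarrow> real ^ 'n \<Rightarrow> real" where
  "lee_form A P g D p v =
     (\<Sum>i\<in>UNIV. \<Sum>j\<in>UNIV.
        matrix_inv (\<chi> k l. g p (axis k 1) (axis l 1)) $ i $ j
        * F_at A P g D p (axis i 1) (axis j 1) v)"

definition W1_manifold ::
    "('m, 'n::finite) chart set \<Rightarrow> ('m \<Rightarrow> real ^ 'n \<Rightarrow> real ^ 'n) \<Rightarrow>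
     ('m \<Rightarrow> real ^ 'n \<Rightarrow> real ^ 'n \<Rightarrow> real) \<Rightarrow> ('m, 'n) connection \<Rightarrow> nat \<Rightarrow> bool" where
  "W1_manifold A P g D n \<longleftrightarrow>
     (let \<theta> = lee_form A P g D in
      \<forall>X Y Z p. smooth_vf A X \<longrightarrow> smooth_vf A Y \<longrightarrow> smooth_vf A Z \<longrightarrow>
        F_tensor P g D X Y Z p = 1 / (2 * real n) *
          (g p (X p) (Y p) * \<theta> p (Z p) - g p (X p) (P p (Y p)) * \<theta> p (P p (Z p))
         + g p (X p) (Z p) * \<theta> p (Y p) - g p (X p) (P p (Z p)) * \<theta> p (P p (Y p))))"

definition W3_bar ::
    "('m, 'n::finite) chart set \<Rightarrow> ('m \<Rightarrow> real ^ 'n \<Rightarrow> real ^ 'n) \<Rightarrow>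
     ('m \<Rightarrow> real ^ 'n \<Rightarrow> real ^ 'n \<Rightarrow> real) \<Rightarrow> ('m, 'n) connection \<Rightarrow> nat \<Rightarrow> bool" where
  "W3_bar A P g D n \<longleftrightarrow>
     (let \<theta> = lee_form A P g D in
      (\<forall>X Y Z p. smooth_vf A X \<longrightarrow> smooth_vf A Y \<longrightarrow> smooth_vf A Z \<longrightarrow>
        F_tensor P g D X Y Z p = 1 / (2 * real n) *
          ((g p (X p) (Y p) + g p (X p) (P p (Y p))) * \<theta> p (Z p)
         + (g p (X p) (Z p) + g p (X p) (P p (Z p))) * \<theta> p (Y p))) \<and>
      (\<forall>p v. \<theta> p (P p v) = - \<theta> p v))"

definition W6_bar ::
    "('m, 'n::finite) chart set \<Rightarrow> ('m \<Rightarrow> real ^ 'n \<Rightarrow> real ^ 'n) \<Rightarrow>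
     ('m \<Rightarrow> real ^ 'n \<Rightarrow> real ^ 'n \<Rightarrow> real) \<Rightarrow> ('m, 'n) connection \<Rightarrow> nat \<Rightarrow> bool" where
  "W6_bar A P g D n \<longleftrightarrow>
     (let \<theta> = lee_form A P g D in
      (\<forall>X Y Z p. smooth_vf A X \<longrightarrow> smooth_vf A Y \<longrightarrow> smooth_vf A Z \<longrightarrow>
        F_tensor P g D X Y Z p = 1 / (2 * real n) *
          ((g p (X p) (Y p) - g p (X p) (P p (Y p))) * \<theta> p (Z p)
         + (g p (X p) (Z p) - g p (X p) (P p (Z p))) * \<theta> p (Y p))) \<and>
      (\<forall>p v. \<theta> p (P p v) = \<theta> p v))"

text \<open>\<open>d\<theta>(X, Y) = X \<theta>(Y) - Y \<theta>(X) - \<theta>([X, Y]) = 0\<close>\<close>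

definition closed_form ::
    "('m, 'n::finite) chart set \<Rightarrow> ('m \<Rightarrow> real ^ 'n \<Rightarrow> real) \<Rightarrow> bool" where
  "closed_form A \<theta> \<longleftrightarrow>
     (\<forall>X Y p. smooth_vf A X \<longrightarrow> smooth_vf A Y \<longrightarrow>
        vf_deriv A X (\<lambda>q. \<theta> q (Y q)) p - vf_deriv A Y (\<lambda>q. \<theta> q (X q)) p
        - \<theta> p (bracket A X Y p) = 0)"

subsection \<open>The natural connections and their curvature\<close>

definition dual_vector ::
    "('m \<Rightarrow> real ^ 'n \<Rightarrow> real ^ 'n \<Rightarrow> real) \<Rightarrow> ('m \<Rightarrow> real ^ 'n \<Rightarrow> real) \<Rightarrow> 'm \<Rightarrow> real ^ 'n" where
  "dual_vector g \<theta> p = (THE u. \<forall>v. g p u v = \<theta> p v)"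

definition natural_connection ::
    "('m, 'n::finite) chart set \<Rightarrow> ('m \<Rightarrow> real ^ 'n \<Rightarrow> real ^ 'n) \<Rightarrow>
     ('m \<Rightarrow> real ^ 'n \<Rightarrow> real ^ 'n \<Rightarrow> real) \<Rightarrow> ('m, 'n) connection \<Rightarrow> nat \<Rightarrow> real \<Rightarrow> real \<Rightarrow>
     ('m, 'n) connection" where
  "natural_connection A P g D n lam mu X Y p =
     (let \<theta> = lee_form A P g D p; \<Omega> = dual_vector g (lee_form A P g D) p;
          x = X p; y = Y p; \<nu> = mu + 1 / (2 * real n) in
      D X Y p
      + g p x (P p y) *\<^sub>R (lam *\<^sub>R P p \<Omega> + mu *\<^sub>R \<Omega>)
      - (lam * \<theta> (P p y) + mu * \<theta> y) *\<^sub>R P p x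
      + g p x y *\<^sub>R (lam *\<^sub>R \<Omega> + \<nu> *\<^sub>R P p \<Omega>)
      - (lam * \<theta> y + \<nu> * \<theta> (P p y)) *\<^sub>R x)"

definition curvature ::
    "('m, 'n::finite) chart set \<Rightarrow> ('m, 'n) connection \<Rightarrow>
     ('m \<Rightarrow> real ^ 'n) \<Rightarrow> ('m \<Rightarrow> real ^ 'n) \<Rightarrow> ('m \<Rightarrow> real ^ 'n) \<Rightarrow> 'm \<Rightarrow> real ^ 'n" where
  "curvature A D X Y Z p = D X (D Y Z) p - D Y (D X Z) p - D (bracket A X Y) Z p"

text \<open>Tensor fields of type \<open>(0,4)\<close>, as \<open>C\<^sup>\<infinity>\<close>-multilinear maps on smooth vector fields.\<close>

type_synonym ('m, 'n) form4 =
  "('m \<Rightarrow> real ^ 'n) \<Rightarrow> ('m \<Rightarrow> real ^ 'n) \<Rightarrow> ('m \<Rightarrow> real ^ 'n) \<Rightarrow> ('m \<Rightarrow> real ^ 'n) \<Rightarrow> 'm \<Rightarrow> real"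

definition curvature04 ::
    "('m, 'n::finite) chart set \<Rightarrow> ('m \<Rightarrow> real ^ 'n \<Rightarrow> real ^ 'n \<Rightarrow> real) \<Rightarrow>
     ('m, 'n) connection \<Rightarrow> ('m, 'n) form4" where
  "curvature04 A g D X Y Z W p = g p (curvature A D X Y Z p) (W p)"

definition Cinf_linear ::
    "('m, 'n::finite) chart set \<Rightarrow> (('m \<Rightarrow> real ^ 'n) \<Rightarrow> 'm \<Rightarrow> real) \<Rightarrow> bool" where
  "Cinf_linear A h \<longleftrightarrow>
     (\<forall>X. smooth_vf A X \<longrightarrow> smooth_fun A (h X)) \<and>
     (\<forall>X Y. smooth_vf A X \<longrightarrow> smooth_vf A Y \<longrightarrow> h (\<lambda>p. X p + Y p) = (\<lambda>p. h X p + h Y p)) \<and>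
     (\<forall>f X. smooth_fun A f \<longrightarrow> smooth_vf A X \<longrightarrow> h (\<lambda>p. f p *\<^sub>R X p) = (\<lambda>p. f p * h X p))"

definition tensor04 :: "('m, 'n::finite) chart set \<Rightarrow> ('m, 'n) form4 \<Rightarrow> bool" where
  "tensor04 A L \<longleftrightarrow>
     (\<forall>X Y Z. smooth_vf A X \<longrightarrow> smooth_vf A Y \<longrightarrow> smooth_vf A Z \<longrightarrow>
        Cinf_linear A (\<lambda>W. L W X Y Z) \<and> Cinf_linear A (\<lambda>W. L X W Y Z) \<and>
        Cinf_linear A (\<lambda>W. L X Y W Z) \<and> Cinf_linear A (\<lambda>W. L X Y Z W))"

definition riemannian_P_tensor ::
    "('m, 'n::finite) chart set \<Rightarrow> ('m \<Rightarrow> real ^ 'n \<Rightarrow> real ^ 'n) \<Rightarrow> ('m, 'n) form4 \<Rightarrow> bool" where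
  "riemannian_P_tensor A P L \<longleftrightarrow>
     tensor04 A L \<and>
     (\<forall>X Y Z W p. smooth_vf A X \<longrightarrow> smooth_vf A Y \<longrightarrow> smooth_vf A Z \<longrightarrow> smooth_vf A W \<longrightarrow>
        L X Y Z W p = - L Y X Z W p \<and>
        L X Y Z W p = - L X Y W Z p \<and>
        L X Y Z W p + L Y Z X W p + L Z X Y W p = 0 \<and>
        L X Y (\<lambda>q. P q (Z q)) (\<lambda>q. P q (W q)) p = L X Y Z W p)"

end

theory Submission
  imports Defs "HOL-Real_Asymp.Real_Asymp"
begin

text \<open>Put \<open>k = 1 / (2n)\<close>, let \<open>\<theta>\<close> be the Lee form and \<open>\<theta>P = \<theta> \<circ> P\<close>, and write \<open>\<alpha> = \<lambda> \<theta>P + \<mu> \<theta>\<close>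
  and \<open>\<beta> = \<lambda> \<theta> + (\<mu> + k) \<theta>P\<close>. In these terms the torsion of the natural connection is
  \<open>T(x,y) = \<alpha>(x) Py - \<alpha>(y) Px + \<beta>(x) y - \<beta>(y) x\<close>. Naturality alone makes \<open>R'(x,y)\<close> skew for \<open>g\<close>
  and lets it commute with \<open>P\<close>, so that the only condition left for a Riemannian \<open>P\<close>-tensor is
  the first Bianchi identity. For a torsion of this shape all terms that are quadratic in \<open>\<alpha>\<close>
  and \<open>\<beta>\<close> cancel, and the cyclic sum of \<open>R'(x,y)z\<close> is the cyclic sum of \<open>d\<alpha>(x,y) Pz + d\<beta>(x,y) z\<close>
  (\<open>first_bianchi\<close>).

  Hence \<open>R'\<close> is a Riemannian \<open>P\<close>-tensor as soon as \<open>\<alpha>\<close> and \<open>\<beta>\<close> are closed. For the converse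
  split the tangent spaces into the eigenspaces of \<open>P\<close>, which are orthogonal and have dimension
  \<open>n \<ge> 2\<close> because \<open>P\<close> is traceless. If \<open>x\<close> and \<open>y\<close> lie in different eigenspaces, take \<open>z\<close> in the
  eigenspace of \<open>x\<close>, orthogonal to \<open>x\<close>: the component along \<open>z\<close> of the vanishing cyclic sum
  gives one of the equations \<open>d\<beta>(x,y) \<plusminus> d\<alpha>(x,y) = 0\<close>, and exchanging \<open>x\<close> and \<open>y\<close> gives the
  other. If \<open>x\<close> and \<open>y\<close> lie in the same eigenspace, then \<open>d\<theta>(x,y)\<close> and \<open>d\<theta>P(x,y)\<close> vanish on
  every \<open>W\<^sub>1\<close>-manifold: with \<open>z\<close> in the other eigenspace the component along \<open>z\<close> of the cyclic
  sum of \<open>R'(x,y)z\<close> is \<open>0\<close>, since \<open>R'(x,y)\<close> is skew and preserves eigenspaces, and the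
  parameters \<open>(0,0)\<close> and \<open>(0,-k)\<close> turn this into the two claims (\<open>eig_same_closed\<close>). Therefore
  \<open>R'\<close> is a Riemannian \<open>P\<close>-tensor if and only if \<open>d\<alpha> = d\<beta> = 0\<close> (\<open>P_tensor_iff\<close>).

  This is a homogeneous linear system for the pair \<open>(d\<theta>, d\<theta>P)\<close> with determinant
  \<open>\<mu>\<^sup>2 + k \<mu> - \<lambda>\<^sup>2\<close>, from which all cases can be read off. On the two subclasses \<open>\<theta>P = \<plusminus> \<theta>\<close>, and
  the system then forces \<open>d\<theta> = 0\<close> because \<open>k \<noteq> 0\<close>.

  The analytic part provides what these arguments need on a manifold given by an atlas: vector
  fields with a prescribed value at a point (by bump functions), the action of a bracket on
  functions (by the symmetry of second derivatives), the Jacobi identity, and the smoothness of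
  \<open>\<theta>\<close> and of its dual field \<open>\<Omega>\<close>.\<close>

section \<open>Functions of class Ck on open sets\<close>

lemma Ck_on_mono_Suc: "Ck_on (Suc k) S f \<Longrightarrow> Ck_on k S f"
proof (induction k arbitrary: f)
  case 0
  then show ?case
    by (auto intro!: continuous_at_imp_continuous_on differentiable_imp_continuous_within)
next
  case (Suc k)
  then show ?case by (metis Ck_on.simps(2))
qed

lemma Ck_on_subset: "Ck_on k S f \<Longrightarrow> T \<subseteq> S \<Longrightarrow> Ck_on k T f"
  by (induction k arbitrary: f) (auto intro: continuous_on_subset)

lemma frechet_derivative_cong_open:
  assumes "open S" "x \<in> S" "\<And>y. y \<in> S \<Longrightarrow> f y = g y"
  shows "frechet_derivative f (at x) = frechet_derivative g (at x)"
proof -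
  have "(f has_derivative D) (at x) \<longleftrightarrow> (g has_derivative D) (at x)" for D
    using assms by (metis has_derivative_transform_within_open)
  then show ?thesis unfolding frechet_derivative_def by simp
qed

lemma differentiable_cong_open:
  assumes "open S" "x \<in> S" "\<And>y. y \<in> S \<Longrightarrow> f y = g y"
  shows "f differentiable (at x) \<longleftrightarrow> g differentiable (at x)"
  unfolding differentiable_def using assms by (metis has_derivative_transform_within_open)

lemma Ck_on_cong:
  assumes "open S" "\<And>y. y \<in> S \<Longrightarrow> f y = g y"
  shows "Ck_on k S f \<longleftrightarrow> Ck_on k S g"
  using assms(2)
proof (induction k arbitrary: f g)
  case 0
  then show ?case by (auto intro!: continuous_on_cong)
next
  case (Suc k)
  have "\<And>v. Ck_on k S (\<lambda>x. frechet_derivative f (at x) v) \<longleftrightarrow> Ck_on k S (\<lambda>x. frechet_derivative g (at x) v)"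
    by (rule Suc.IH) (metis Suc.prems assms(1) frechet_derivative_cong_open)
  moreover have "\<And>x. x \<in> S \<Longrightarrow> f differentiable (at x) \<longleftrightarrow> g differentiable (at x)"
    using Suc.prems assms(1) differentiable_cong_open by blast
  ultimately show ?case by simp
qed

text \<open>Needed because smoothness on a manifold can often be checked only near each point, by a
  different argument at different points.\<close>

lemma Ck_on_local:
  assumes "\<And>x. x \<in> S \<Longrightarrow> \<exists>U. open U \<and> x \<in> U \<and> Ck_on k U f"
  shows "Ck_on k S f"
  using assms
proof (induction k arbitrary: f)
  case 0
  have "continuous (at x) f" if "x \<in> S" for x
    using 0[OF that] by (auto simp: continuous_on_eq_continuous_at)
  then show ?case by (auto intro: continuous_at_imp_continuous_on)
next
  case (Suc k)
  have "f differentiable (at x)" if "x \<in> S" for x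
    using Suc.prems[OF that] by auto
  moreover have "Ck_on k S (\<lambda>x. frechet_derivative f (at x) v)" for v
    by (rule Suc.IH) (use Suc.prems in fastforce)
  ultimately show ?case by simp
qed

lemma Ck_on_const: "Ck_on k S (\<lambda>x. c)"
  by (induction k arbitrary: c) auto


lemma Ck_on_SucI:
  assumes "open S" "\<And>x. x \<in> S \<Longrightarrow> (f has_derivative f' x) (at x)"
    and "\<And>v. Ck_on k S (\<lambda>x. f' x v)"
  shows "Ck_on (Suc k) S f"
proof -
  have "Ck_on k S (\<lambda>x. frechet_derivative f (at x) v)" for v
    using assms(3)[of v]
    by (rule Ck_on_cong[OF assms(1), THEN iffD1, rotated]) (metis assms(2) frechet_derivative_at)
  then show ?thesis using assms(2) by (auto simp: differentiable_def)
qed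

lemma Ck_on_SucD:
  assumes "Ck_on (Suc k) S f"
  shows "\<And>x. x \<in> S \<Longrightarrow> (f has_derivative frechet_derivative f (at x)) (at x)"
    and "\<And>v. Ck_on k S (\<lambda>x. frechet_derivative f (at x) v)"
    and "Ck_on k S f"
  using assms Ck_on_mono_Suc[OF assms] by (auto simp: frechet_derivative_works[symmetric])

lemma Ck_on_bounded_linear:
  assumes "bounded_linear L" "open S"
  shows "Ck_on k S f \<Longrightarrow> Ck_on k S (\<lambda>x. L (f x))"
proof (induction k arbitrary: f)
  case 0
  then show ?case by (auto intro: bounded_linear.continuous_on[OF assms(1)])
next
  case (Suc k)
  note f = Ck_on_SucD[OF Suc.prems]
  show ?case
    by (rule Ck_on_SucI[OF assms(2) bounded_linear.has_derivative[OF assms(1) f(1)]])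
      (auto intro: Suc.IH f)
qed

lemma Ck_on_add:
  assumes "open S"
  shows "Ck_on k S f \<Longrightarrow> Ck_on k S g \<Longrightarrow> Ck_on k S (\<lambda>x. f x + g x)"
proof (induction k arbitrary: f g)
  case 0
  then show ?case by (auto intro: continuous_on_add)
next
  case (Suc k)
  note f = Ck_on_SucD[OF Suc.prems(1)] and g = Ck_on_SucD[OF Suc.prems(2)]
  show ?case
    by (rule Ck_on_SucI[OF assms has_derivative_add[OF f(1) g(1)]]) (auto intro: Suc.IH f g)
qed

lemma Ck_on_bilinear:
  assumes "bounded_bilinear B" "open S"
  shows "Ck_on k S f \<Longrightarrow> Ck_on k S g \<Longrightarrow> Ck_on k S (\<lambda>x. B (f x) (g x))"
proof (induction k arbitrary: f g)
  case 0
  then show ?case by (auto intro: bounded_bilinear.continuous_on[OF assms(1)])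
next
  case (Suc k)
  note f = Ck_on_SucD[OF Suc.prems(1)] and g = Ck_on_SucD[OF Suc.prems(2)]
  show ?case
    by (rule Ck_on_SucI[OF assms(2) bounded_bilinear.FDERIV[OF assms(1) f(1) g(1)]])
      (auto intro!: Ck_on_add[OF assms(2)] Suc.IH f g)
qed

lemmas Ck_on_scaleR = Ck_on_bilinear[OF bounded_bilinear_scaleR]
lemmas Ck_on_mult = Ck_on_bilinear[OF bounded_bilinear_mult]

lemma Ck_on_sum:
  assumes "open S" "finite I" "\<And>i. i \<in> I \<Longrightarrow> Ck_on k S (f i)"
  shows "Ck_on k S (\<lambda>x. \<Sum>i\<in>I. f i x)"
  using assms(2,3) by (induction I) (auto intro: Ck_on_const Ck_on_add[OF assms(1)])

lemma Ck_on_inverse: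
  fixes f :: "'a::real_normed_vector \<Rightarrow> real"
  assumes "open S" "\<And>x. x \<in> S \<Longrightarrow> f x \<noteq> 0"
  shows "Ck_on k S f \<Longrightarrow> Ck_on k S (\<lambda>x. inverse (f x))"
proof (induction k)
  case 0
  then show ?case using assms by (auto intro: continuous_on_inverse)
next
  case (Suc k)
  note f = Ck_on_SucD[OF Suc.prems]
  have i: "Ck_on k S (\<lambda>x. inverse (f x))" by (rule Suc.IH[OF f(3)])
  show ?case
    by (rule Ck_on_SucI[OF assms(1) Deriv.has_derivative_inverse[OF assms(2) f(1)]])
      (auto intro!: Ck_on_bounded_linear[OF bounded_linear_minus[OF bounded_linear_ident] assms(1)]
        Ck_on_mult[OF assms(1)] i f)
qed

text \<open>The derivative of \<open>g \<circ> f\<close> is expanded in a basis, so that it becomes a sum of products of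
  functions to which the induction hypothesis applies.\<close>

lemma Ck_on_compose:
  fixes f :: "'a::real_normed_vector \<Rightarrow> 'b::euclidean_space"
  assumes "open S" "open T" "f ` S \<subseteq> T"
  shows "Ck_on k S f \<Longrightarrow> Ck_on k T g \<Longrightarrow> Ck_on k S (\<lambda>x. g (f x))"
proof (induction k arbitrary: g)
  case 0
  then show ?case using assms(3) by (auto intro: continuous_on_compose2)
next
  case (Suc k)
  note f = Ck_on_SucD[OF Suc.prems(1)] and g = Ck_on_SucD[OF Suc.prems(2)]
  let ?D = "\<lambda>x v. \<Sum>b\<in>Basis. (frechet_derivative f (at x) v \<bullet> b) *\<^sub>R frechet_derivative g (at (f x)) b"
  have 1: "((\<lambda>x. g (f x)) has_derivative ?D x) (at x)" if x: "x \<in> S" for x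
  proof -
    have fx: "f x \<in> T" using assms(3) x by auto
    have l: "linear (frechet_derivative g (at (f x)))"
      using g(1)[OF fx] has_derivative_linear by blast
    have "frechet_derivative g (at (f x)) (frechet_derivative f (at x) v) = ?D x v" for v
      by (subst euclidean_representation[of "frechet_derivative f (at x) v", symmetric])
        (simp only: linear_sum[OF l] linear_cmul[OF l])
    moreover have "((\<lambda>x. g (f x)) has_derivative
        (\<lambda>v. frechet_derivative g (at (f x)) (frechet_derivative f (at x) v))) (at x)"
      by (rule has_derivative_compose[OF f(1)[OF x] g(1)[OF fx]])
    ultimately show ?thesis by simp
  qed
  have 2: "Ck_on k S (\<lambda>x. ?D x v)" for v
    by (intro Ck_on_sum Ck_on_scaleR Ck_on_bounded_linear[OF bounded_linear_inner_left]
        Suc.IH f g assms(1) finite_Basis)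
  show ?case by (rule Ck_on_SucI[OF assms(1) 1 2])
qed

lemma Cinf_on_subset: "Cinf_on S f \<Longrightarrow> T \<subseteq> S \<Longrightarrow> Cinf_on T f"
  unfolding Cinf_on_def using Ck_on_subset by blast

lemma Cinf_on_cong:
  "open S \<Longrightarrow> (\<And>y. y \<in> S \<Longrightarrow> f y = g y) \<Longrightarrow> Cinf_on S f \<longleftrightarrow> Cinf_on S g"
  unfolding Cinf_on_def using Ck_on_cong by blast

lemma Cinf_on_local:
  "(\<And>x. x \<in> S \<Longrightarrow> \<exists>U. open U \<and> x \<in> U \<and> Cinf_on U f) \<Longrightarrow> Cinf_on S f"
  unfolding Cinf_on_def by (meson Ck_on_local)

lemma Cinf_on_const: "Cinf_on S (\<lambda>x. c)"
  unfolding Cinf_on_def by (blast intro: Ck_on_const)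

lemma Cinf_on_bounded_linear:
  "bounded_linear L \<Longrightarrow> open S \<Longrightarrow> Cinf_on S f \<Longrightarrow> Cinf_on S (\<lambda>x. L (f x))"
  unfolding Cinf_on_def by (blast intro: Ck_on_bounded_linear)

lemma Cinf_on_add: "open S \<Longrightarrow> Cinf_on S f \<Longrightarrow> Cinf_on S g \<Longrightarrow> Cinf_on S (\<lambda>x. f x + g x)"
  unfolding Cinf_on_def by (blast intro: Ck_on_add)

lemma Cinf_on_scaleR:
  "open S \<Longrightarrow> Cinf_on S f \<Longrightarrow> Cinf_on S g \<Longrightarrow> Cinf_on S (\<lambda>x. f x *\<^sub>R g x)"
  unfolding Cinf_on_def by (blast intro: Ck_on_scaleR)

lemma Cinf_on_mult:
  fixes f g :: "'a::real_normed_vector \<Rightarrow> real"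
  shows "open S \<Longrightarrow> Cinf_on S f \<Longrightarrow> Cinf_on S g \<Longrightarrow> Cinf_on S (\<lambda>x. f x * g x)"
  unfolding Cinf_on_def by (blast intro: Ck_on_mult)

lemma Cinf_on_sum:
  "open S \<Longrightarrow> finite I \<Longrightarrow> (\<And>i. i \<in> I \<Longrightarrow> Cinf_on S (f i)) \<Longrightarrow> Cinf_on S (\<lambda>x. \<Sum>i\<in>I. f i x)"
  unfolding Cinf_on_def by (blast intro: Ck_on_sum)

lemma Cinf_on_inverse:
  fixes f :: "'a::real_normed_vector \<Rightarrow> real"
  shows "open S \<Longrightarrow> (\<And>x. x \<in> S \<Longrightarrow> f x \<noteq> 0) \<Longrightarrow> Cinf_on S f \<Longrightarrow> Cinf_on S (\<lambda>x. inverse (f x))"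
  unfolding Cinf_on_def by (blast intro: Ck_on_inverse)

lemma Cinf_on_compose:
  fixes f :: "'a::real_normed_vector \<Rightarrow> 'b::euclidean_space"
  shows "open S \<Longrightarrow> open T \<Longrightarrow> f ` S \<subseteq> T \<Longrightarrow> Cinf_on S f \<Longrightarrow> Cinf_on T g
    \<Longrightarrow> Cinf_on S (\<lambda>x. g (f x))"
  unfolding Cinf_on_def by (blast intro: Ck_on_compose)

lemma Cinf_on_id: 
  assumes "open S" shows "Cinf_on S (\<lambda>x. x)"
proof -
  have "Ck_on k S (\<lambda>x. x)" for k
    by (cases k) (auto intro!: Ck_on_SucI[OF assms has_derivative_ident] Ck_on_const continuous_on_id
      simp del: Ck_on.simps(2))
  then show ?thesis unfolding Cinf_on_def by blast
qed

lemma Cinf_on_deriv: "Cinf_on S f \<Longrightarrow> Cinf_on S (\<lambda>x. frechet_derivative f (at x) v)"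
  unfolding Cinf_on_def using Ck_on_SucD(2) by blast

lemma Cinf_on_has_derivative:
  "Cinf_on S f \<Longrightarrow> x \<in> S \<Longrightarrow> (f has_derivative frechet_derivative f (at x)) (at x)"
  unfolding Cinf_on_def using Ck_on_SucD(1) by blast

text \<open>Differentiation along a variable vector: expanding the vector in a basis reduces it to the
  directional derivatives with constant direction that occur in the definition of smoothness.\<close>

lemma Cinf_on_deriv_field:
  fixes f :: "'a::euclidean_space \<Rightarrow> 'b::real_normed_vector"
  assumes "open S" "Cinf_on S f" "Cinf_on S v"
  shows "Cinf_on S (\<lambda>x. frechet_derivative f (at x) (v x))"
proof -
  have *: "frechet_derivative f (at x) (v x) = (\<Sum>b\<in>Basis. (v x \<bullet> b) *\<^sub>R frechet_derivative f (at x) b)"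
    if "x \<in> S" for x
  proof -
    have l: "linear (frechet_derivative f (at x))"
      using Cinf_on_has_derivative[OF assms(2) that] has_derivative_linear by blast
    show ?thesis
      by (subst euclidean_representation[of "v x", symmetric])
        (simp only: linear_sum[OF l] linear_cmul[OF l])
  qed
  have "Cinf_on S (\<lambda>x. \<Sum>b\<in>Basis. (v x \<bullet> b) *\<^sub>R frechet_derivative f (at x) b)"
    by (intro Cinf_on_sum Cinf_on_scaleR Cinf_on_bounded_linear[OF bounded_linear_inner_left]
        Cinf_on_deriv assms finite_Basis)
  with * show ?thesis using Cinf_on_cong[OF assms(1)] by (metis (no_types, lifting))
qed

section \<open>Symmetry of second derivatives\<close>

text \<open>The second difference \<open>f(x+hu+hv) - f(x+hu) - f(x+hv) + f(x)\<close> is symmetric in \<open>u\<close> and \<open>v\<close>, and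
  two applications of the mean value theorem turn it into \<open>h\<^sup>2\<close> times an iterated derivative at a
  point that is close to \<open>x\<close>.\<close>

lemma second_difference:
  fixes f :: "'a::real_normed_vector \<Rightarrow> real"
  assumes C: "Ck_on (Suc (Suc 0)) S f" and h: "0 < h"
    and S: "\<And>s t. 0 \<le> s \<Longrightarrow> s \<le> h \<Longrightarrow> 0 \<le> t \<Longrightarrow> t \<le> h \<Longrightarrow> x + s *\<^sub>R u + t *\<^sub>R v \<in> S"
  shows "\<exists>s t. 0 < s \<and> s < h \<and> 0 < t \<and> t < h \<and>
    f (x + h *\<^sub>R u + h *\<^sub>R v) - f (x + h *\<^sub>R u) - f (x + h *\<^sub>R v) + f x
    = h * h * frechet_derivative (\<lambda>y. frechet_derivative f (at y) u) (at (x + s *\<^sub>R u + t *\<^sub>R v)) v"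
proof -
  note f = Ck_on_SucD[OF C]
  define D where "D y = frechet_derivative f (at y)" for y
  define E where "E y = frechet_derivative (\<lambda>y. D y u) (at y)" for y
  have D: "(f has_derivative D y) (at y)" if "y \<in> S" for y
    using f(1)[OF that] by (simp add: D_def)
  have E: "((\<lambda>y. D y u) has_derivative E y) (at y)" if "y \<in> S" for y
    using Ck_on_SucD(1)[OF f(2) that] by (simp add: D_def E_def)
  define \<phi> where "\<phi> s = f (x + s *\<^sub>R u + h *\<^sub>R v) - f (x + s *\<^sub>R u + 0 *\<^sub>R v)" for s
  have d1: "(\<phi> has_derivative (\<lambda>r. D (x + s *\<^sub>R u + h *\<^sub>R v) (r *\<^sub>R u) - D (x + s *\<^sub>R u + 0 *\<^sub>R v) (r *\<^sub>R u)))
      (at s)" if "0 \<le> s" "s \<le> h" for s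
    unfolding \<phi>_def
    by (intro has_derivative_diff has_derivative_compose[OF _ D] S)
      (use that h in \<open>auto intro!: derivative_eq_intros\<close>)
  have cd1: "continuous_on {0..h} \<phi>"
    by (rule has_derivative_continuous_on[OF has_derivative_at_withinI[OF d1]]) auto
  obtain s where s: "0 < s" "s < h"
    "\<phi> h - \<phi> 0 = D (x + s *\<^sub>R u + h *\<^sub>R v) ((h - 0) *\<^sub>R u) - D (x + s *\<^sub>R u + 0 *\<^sub>R v) ((h - 0) *\<^sub>R u)"
    by (rule mvt[OF h cd1 d1]) auto
  have lin: "D y (h *\<^sub>R u) = h * D y u" if "y \<in> S" for y
    using linear_cmul[OF has_derivative_linear[OF D[OF that]]] by simp
  define \<psi> where "\<psi> t = D (x + s *\<^sub>R u + t *\<^sub>R v) u" for t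
  have d2: "(\<psi> has_derivative (\<lambda>r. E (x + s *\<^sub>R u + t *\<^sub>R v) (r *\<^sub>R v))) (at t)"
    if "0 \<le> t" "t \<le> h" for t
    unfolding \<psi>_def
    by (intro has_derivative_compose[OF _ E] S)
      (use that s in \<open>auto intro!: derivative_eq_intros\<close>)
  have cd2: "continuous_on {0..h} \<psi>"
    by (rule has_derivative_continuous_on[OF has_derivative_at_withinI[OF d2]]) auto
  obtain t where t: "0 < t" "t < h" "\<psi> h - \<psi> 0 = E (x + s *\<^sub>R u + t *\<^sub>R v) ((h - 0) *\<^sub>R v)"
    by (rule mvt[OF h cd2 d2]) auto
  have "E (x + s *\<^sub>R u + t *\<^sub>R v) (h *\<^sub>R v) = h * E (x + s *\<^sub>R u + t *\<^sub>R v) v"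
    using linear_cmul[OF has_derivative_linear[OF E[OF S]]] s t by simp
  with t(3) have "\<psi> h - \<psi> 0 = h * E (x + s *\<^sub>R u + t *\<^sub>R v) v" by simp
  moreover have "\<phi> h - \<phi> 0 = h * (\<psi> h - \<psi> 0)"
    using s lin[OF S, of s h] lin[OF S, of s 0] h by (simp add: \<psi>_def algebra_simps)
  ultimately have "f (x + h *\<^sub>R u + h *\<^sub>R v) - f (x + h *\<^sub>R u) - f (x + h *\<^sub>R v) + f x
    = h * h * E (x + s *\<^sub>R u + t *\<^sub>R v) v"
    by (simp add: \<phi>_def)
  with s t show ?thesis unfolding E_def D_def by blast
qed

text \<open>Both iterated derivatives are limits of the same symmetric second difference quotient.\<close>

lemma second_derivative_symmetric:
  fixes f :: "'a::real_normed_vector \<Rightarrow> real"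
  assumes S: "open S" "x \<in> S" and C: "Ck_on (Suc (Suc 0)) S f"
  shows "frechet_derivative (\<lambda>y. frechet_derivative f (at y) u) (at x) v
    = frechet_derivative (\<lambda>y. frechet_derivative f (at y) v) (at x) u"
proof -
  define E where "E u v y = frechet_derivative (\<lambda>y. frechet_derivative f (at y) u) (at y) v" for u v y
  have cE: "isCont (E u v) x" for u v
    using Ck_on_SucD(2)[OF Ck_on_SucD(2)[OF C]] S
    by (simp add: E_def[abs_def] continuous_on_eq_continuous_at)
  have "\<bar>E u v x - E v u x\<bar> < e" if e: "e > 0" for e
  proof -
    have 0: "\<exists>d>0. \<forall>y. dist y x < d \<longrightarrow> \<bar>E u v y - E u v x\<bar> < e/2" for u v
      using cE[of u v] e unfolding continuous_at_eps_delta
      by (metis dist_real_def half_gt_zero)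
    obtain d1 where d1: "d1 > 0" "\<And>y. dist y x < d1 \<Longrightarrow> \<bar>E u v y - E u v x\<bar> < e/2"
      using 0 by blast
    obtain d2 where d2: "d2 > 0" "\<And>y. dist y x < d2 \<Longrightarrow> \<bar>E v u y - E v u x\<bar> < e/2"
      using 0 by blast
    obtain d3 where d3: "d3 > 0" "\<And>y. dist y x < d3 \<Longrightarrow> y \<in> S"
      using S open_dist by blast
    define d where "d = min d1 (min d2 d3)"
    \<comment> \<open>So small that the whole parallelogram with sides \<open>h u\<close>, \<open>h v\<close> stays within \<open>d\<close> of \<open>x\<close>.\<close>
    define h where "h = d / (2 * (norm u + norm v + 1))"
    have dpos: "d > 0" using d1 d2 d3 by (simp add: d_def)
    have np: "2 * (norm u + norm v + 1) > 0" by (smt (verit) norm_ge_zero)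
    have h: "h > 0" using dpos np by (simp add: h_def)
    have near: "dist (x + s *\<^sub>R u + t *\<^sub>R v) x < d" if "0 \<le> s" "s \<le> h" "0 \<le> t" "t \<le> h" for s t
    proof -
      have "dist (x + s *\<^sub>R u + t *\<^sub>R v) x = norm (s *\<^sub>R u + t *\<^sub>R v)" by (simp add: dist_norm)
      also have "\<dots> \<le> s * norm u + t * norm v"
        using norm_triangle_ineq[of "s *\<^sub>R u" "t *\<^sub>R v"] that by simp
      also have "\<dots> \<le> h * norm u + h * norm v"
        using that by (intro add_mono mult_right_mono) auto
      also have "\<dots> < h * (2 * (norm u + norm v + 1))"
        using h by (simp add: algebra_simps) (smt (verit) mult_nonneg_nonneg norm_ge_zero)
      also have "\<dots> = d" unfolding h_def using np by (simp only: nonzero_eq_divide_eq times_divide_eq_left) simp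
      finally show ?thesis .
    qed
    obtain s t where st: "0 < s" "s < h" "0 < t" "t < h"
      "f (x + h *\<^sub>R u + h *\<^sub>R v) - f (x + h *\<^sub>R u) - f (x + h *\<^sub>R v) + f x
        = h * h * E u v (x + s *\<^sub>R u + t *\<^sub>R v)"
      using second_difference[OF C h, of x u v] near d3 unfolding E_def d_def by fastforce
    obtain s' t' where st': "0 < s'" "s' < h" "0 < t'" "t' < h"
      "f (x + h *\<^sub>R v + h *\<^sub>R u) - f (x + h *\<^sub>R v) - f (x + h *\<^sub>R u) + f x
        = h * h * E v u (x + s' *\<^sub>R v + t' *\<^sub>R u)"
    proof -
      have "x + s *\<^sub>R v + t *\<^sub>R u \<in> S" if "0 \<le> s" "s \<le> h" "0 \<le> t" "t \<le> h" for s t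
        using near[of t s] that d3 by (simp add: d_def algebra_simps)
      from second_difference[OF C h this] that show ?thesis unfolding E_def by blast
    qed
    have "h * h * E u v (x + s *\<^sub>R u + t *\<^sub>R v) = h * h * E v u (x + s' *\<^sub>R v + t' *\<^sub>R u)"
      using st(5) st'(5) by (simp add: algebra_simps)
    then have eq: "E u v (x + s *\<^sub>R u + t *\<^sub>R v) = E v u (x + s' *\<^sub>R v + t' *\<^sub>R u)"
      using h by simp
    have "\<bar>E u v (x + s *\<^sub>R u + t *\<^sub>R v) - E u v x\<bar> < e/2"
      using near[of s t] st by (intro d1) (auto simp: d_def)
    moreover have "\<bar>E v u (x + s' *\<^sub>R v + t' *\<^sub>R u) - E v u x\<bar> < e/2"
      using near[of t' s'] st' by (intro d2) (auto simp: d_def algebra_simps)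
    ultimately show ?thesis using eq by linarith
  qed
  then have "E u v x = E v u x"
    by (metis abs_0 abs_le_zero_iff eq_iff_diff_eq_0 less_irrefl linorder_not_le)
  then show ?thesis by (simp add: E_def)
qed

section \<open>Bump functions\<close>

text \<open>The functions \<open>exp (- 1 / t) / t ^ k\<close>, continued by \<open>0\<close>, are closed under differentiation up
  to linear combinations; for \<open>k = 0\<close> this is the usual flat function.\<close>

definition flat_fun :: "nat \<Rightarrow> real \<Rightarrow> real" where
  "flat_fun k t = (if t > 0 then exp (- (1 / t)) / t ^ k else 0)"

text \<open>The only point that is not plain calculus is \<open>t = 0\<close>, where \<open>exp (- 1 / t)\<close> decays faster
  than every power of \<open>t\<close>.\<close>

lemma flat_fun_deriv:
  "(flat_fun k has_real_derivative (flat_fun (k + 2) t - real k * flat_fun (k + 1) t)) (at t)"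
proof -
  consider "t > 0" | "t < 0" | "t = 0" by linarith
  then show ?thesis
  proof cases
    case 1
    have "((\<lambda>t. exp (- (1 / t)) / t ^ k) has_real_derivative
        (flat_fun (k + 2) t - real k * flat_fun (k + 1) t)) (at t)"
      using 1
      by (auto intro!: derivative_eq_intros simp: flat_fun_def field_simps power2_eq_square)
        (cases k; simp add: field_simps)
    then show ?thesis
      by (rule has_field_derivative_transform_within_open[of _ _ _ "{0<..}"])
        (use 1 in \<open>auto simp: flat_fun_def\<close>)
  next
    case 2
    have "((\<lambda>t. 0) has_real_derivative (flat_fun (k + 2) t - real k * flat_fun (k + 1) t)) (at t)"
      using 2 by (simp add: flat_fun_def)
    then show ?thesis
      by (rule has_field_derivative_transform_within_open[of _ _ _ "{..<0}"])
        (use 2 in \<open>auto simp: flat_fun_def\<close>)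
  next
    case 3
    have "((\<lambda>h. exp (- (1 / h)) / h ^ Suc k) \<longlongrightarrow> 0) (at_right (0::real))"
      by real_asymp
    then have "((\<lambda>h. flat_fun k h / h) \<longlongrightarrow> 0) (at_right 0)"
      by (rule Lim_transform_eventually)
        (auto simp: flat_fun_def eventually_at_filter field_simps)
    moreover have "((\<lambda>h. flat_fun k h / h) \<longlongrightarrow> 0) (at_left 0)"
      by (rule tendsto_eventually) (auto simp: flat_fun_def eventually_at_filter)
    ultimately have "((\<lambda>h. flat_fun k h / h) \<longlongrightarrow> 0) (at 0)"
      by (simp add: filterlim_split_at)
    then show ?thesis
      using 3 by (simp add: has_field_derivative_iff flat_fun_def)
  qed
qed

lemma Cinf_on_flat_fun: "Cinf_on UNIV (flat_fun k)"
proof -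
  have "Ck_on j UNIV (flat_fun k)" for j
  proof (induction j arbitrary: k)
    case 0
    then show ?case
      by (auto intro!: continuous_at_imp_continuous_on DERIV_isCont[OF flat_fun_deriv])
  next
    case (Suc j)
    show ?case
    proof (rule Ck_on_SucI[OF open_UNIV])
      show "(flat_fun k has_derivative (*) (flat_fun (k + 2) x - real k * flat_fun (k + 1) x)) (at x)" for x
        using flat_fun_deriv unfolding has_field_derivative_def .
      have "Ck_on j UNIV (\<lambda>x. (flat_fun (k + 2) x + - real k * flat_fun (k + 1) x) * v)" for v
        by (intro Ck_on_mult Ck_on_add Ck_on_const Suc.IH open_UNIV)
      then show "Ck_on j UNIV (\<lambda>x. (flat_fun (k + 2) x - real k * flat_fun (k + 1) x) * v)" for v
        by simp
    qed
  qed
  then show ?thesis unfolding Cinf_on_def by blast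
qed

lemma Cinf_on_inner:
  "open S \<Longrightarrow> Cinf_on S f \<Longrightarrow> Cinf_on S g \<Longrightarrow> Cinf_on S (\<lambda>x. f x \<bullet> g x)"
  unfolding Cinf_on_def by (blast intro: Ck_on_bilinear[OF bounded_bilinear_inner])

text \<open>The flat function of \<open>r\<^sup>2 - |x - a|\<^sup>2\<close> vanishes outside the ball; the factor
  \<open>exp (1 / r\<^sup>2)\<close> normalises its value at the centre.\<close>

lemma bump_function:
  fixes a :: "'a::euclidean_space"
  assumes "r > 0"
  shows "\<exists>\<phi>::'a \<Rightarrow> real. Cinf_on UNIV \<phi> \<and> \<phi> a = 1 \<and> (\<forall>x. x \<notin> cball a r \<longrightarrow> \<phi> x = 0)"
proof -
  define q where "q x = r\<^sup>2 + - 1 * ((x + - a) \<bullet> (x + - a))" for x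
  have q: "Cinf_on UNIV q" unfolding q_def
    by (intro Cinf_on_add Cinf_on_mult Cinf_on_inner Cinf_on_const Cinf_on_id open_UNIV)
  have "Cinf_on UNIV (\<lambda>x. exp (1 / r\<^sup>2) * flat_fun 0 (q x))"
    by (intro Cinf_on_mult Cinf_on_const Cinf_on_compose[OF _ open_UNIV _ q] Cinf_on_flat_fun open_UNIV) auto
  moreover have "exp (1 / r\<^sup>2) * flat_fun 0 (q a) = 1"
    using assms by (simp add: q_def flat_fun_def flip: exp_add)
  moreover have "exp (1 / r\<^sup>2) * flat_fun 0 (q x) = 0" if "x \<notin> cball a r" for x
  proof -
    have "r < norm (x - a)" using that by (simp add: dist_norm norm_minus_commute)
    then have "r\<^sup>2 < (norm (x - a))\<^sup>2" using assms by (simp add: power_strict_mono)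
    then show ?thesis by (simp add: q_def flat_fun_def power2_norm_eq_inner)
  qed
  ultimately show ?thesis by blast
qed

section \<open>Smooth functions and vector fields on a manifold\<close>

locale smooth_mfd =
  fixes A :: "('m::{t2_space,second_countable_topology}, 'n::finite) chart set"
  assumes atlas: "smooth_atlas A"
begin

lemma chart_at_mem: "chart_at A p \<in> A" and chart_at_dom: "p \<in> dom_of (chart_at A p)"
proof -
  have "\<exists>c. c \<in> A \<and> p \<in> dom_of c" using atlas unfolding smooth_atlas_def by blast
  then have "chart_at A p \<in> A \<and> p \<in> dom_of (chart_at A p)"
    unfolding chart_at_def by (rule someI_ex)
  then show "chart_at A p \<in> A" "p \<in> dom_of (chart_at A p)" by auto
qed

lemma chart_homeo: "c \<in> A \<Longrightarrow> homeomorphism (dom_of c) (coord c ` dom_of c) (coord c) (param c)"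
  and open_dom: "c \<in> A \<Longrightarrow> open (dom_of c)"
  and open_coord: "c \<in> A \<Longrightarrow> open (coord c ` dom_of c)"
  using atlas unfolding smooth_atlas_def by auto

lemma param_coord [simp]: "c \<in> A \<Longrightarrow> p \<in> dom_of c \<Longrightarrow> param c (coord c p) = p"
  by (rule homeomorphism_apply1[OF chart_homeo])

lemma open_coord_image:
  assumes "c \<in> A" "open U" "U \<subseteq> dom_of c"
  shows "open (coord c ` U)"
proof -
  have "openin (top_of_set (coord c ` dom_of c)) (coord c ` U)"
    using homeomorphism_imp_open_map[OF chart_homeo[OF assms(1)]] assms(2,3)
    by (simp add: open_openin_trans open_dom[OF assms(1)])
  then show ?thesis using open_coord[OF assms(1)] openin_open_trans by blast
qed

lemma trans_smooth:
  "c \<in> A \<Longrightarrow> d \<in> A \<Longrightarrow> Cinf_on (coord c ` (dom_of c \<inter> dom_of d)) (\<lambda>x. coord d (param c x))"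
  using atlas unfolding smooth_atlas_def by (auto simp: o_def)

lemma open_overlap: "c \<in> A \<Longrightarrow> d \<in> A \<Longrightarrow> open (coord c ` (dom_of c \<inter> dom_of d))"
  by (rule open_coord_image) (auto simp: open_dom)

lemma trans_has_derivative:
  assumes "c \<in> A" "d \<in> A" "p \<in> dom_of c" "p \<in> dom_of d"
  shows "((\<lambda>x. coord d (param c x)) has_derivative coord_change c d p) (at (coord c p))"
  using Cinf_on_has_derivative[OF trans_smooth[OF assms(1,2)], of "coord c p"] assms
  by (auto simp: coord_change_def[abs_def] o_def)

lemma coord_change_linear:
  "c \<in> A \<Longrightarrow> d \<in> A \<Longrightarrow> p \<in> dom_of c \<Longrightarrow> p \<in> dom_of d \<Longrightarrow> linear (coord_change c d p)"
  using trans_has_derivative has_derivative_linear by blast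

text \<open>The chain rule, applied to \<open>coord e \<circ> param d \<circ> coord d \<circ> param c\<close>; this is what makes
  tangent vectors independent of the chart.\<close>

lemma coord_change_compose:
  assumes "c \<in> A" "d \<in> A" "e \<in> A" "p \<in> dom_of c" "p \<in> dom_of d" "p \<in> dom_of e"
  shows "coord_change d e p (coord_change c d p v) = coord_change c e p v"
proof -
  have "((\<lambda>x. coord e (param d x)) has_derivative coord_change d e p) (at (coord d (param c (coord c p))))"
    using trans_has_derivative[OF assms(2,3,5,6)] assms by simp
  from has_derivative_compose[OF trans_has_derivative[OF assms(1,2,4,5)] this]
  have 1: "((\<lambda>x. coord e (param d (coord d (param c x)))) has_derivative
      (\<lambda>v. coord_change d e p (coord_change c d p v))) (at (coord c p))" .
  have "((\<lambda>x. coord e (param c x)) has_derivative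
      (\<lambda>v. coord_change d e p (coord_change c d p v))) (at (coord c p))"
    by (rule has_derivative_transform_within_open[OF 1 open_overlap[OF assms(1,2)]])
      (use assms in auto)
  from has_derivative_unique[OF this trans_has_derivative[OF assms(1,3,4,6)]]
  show ?thesis by (metis (no_types))
qed

lemma coord_change_self:
  assumes "c \<in> A" "p \<in> dom_of c"
  shows "coord_change c c p v = v"
proof -
  have "((\<lambda>x. coord c (param c x)) has_derivative (\<lambda>v. v)) (at (coord c p))"
    by (rule has_derivative_transform_within_open[OF has_derivative_ident open_coord[OF assms(1)]])
      (use assms in auto)
  from has_derivative_unique[OF this trans_has_derivative[OF assms(1,1,2,2)]]
  show ?thesis by metis
qed

lemma vf_rep_coord:
  "c \<in> A \<Longrightarrow> p \<in> dom_of c \<Longrightarrow> vf_rep A c X (coord c p) = coord_change (chart_at A p) c p (X p)"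
  by (simp add: vf_rep_def)

lemma vf_rep_chart_at: "vf_rep A (chart_at A p) X (coord (chart_at A p) p) = X p"
  by (simp add: vf_rep_coord chart_at_mem chart_at_dom coord_change_self)

lemma vf_rep_lin:
  assumes "c \<in> A" "x \<in> coord c ` dom_of c"
  shows "vf_rep A c (\<lambda>p. X p + Y p) x = vf_rep A c X x + vf_rep A c Y x"
    and "vf_rep A c (\<lambda>p. f p *\<^sub>R X p) x = f (param c x) *\<^sub>R vf_rep A c X x"
proof -
  obtain p where p: "p \<in> dom_of c" "x = coord c p" using assms(2) by auto
  have l: "linear (coord_change (chart_at A p) c p)"
    using assms p by (intro coord_change_linear chart_at_mem chart_at_dom)
  show "vf_rep A c (\<lambda>p. X p + Y p) x = vf_rep A c X x + vf_rep A c Y x"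
    "vf_rep A c (\<lambda>p. f p *\<^sub>R X p) x = f (param c x) *\<^sub>R vf_rep A c X x"
    using p assms by (simp_all add: vf_rep_coord linear_add[OF l] linear_cmul[OF l])
qed

abbreviation sf :: "('m \<Rightarrow> real) \<Rightarrow> bool" where "sf \<equiv> smooth_fun A"
abbreviation sv :: "('m \<Rightarrow> real ^ 'n) \<Rightarrow> bool" where "sv \<equiv> smooth_vf A"

lemma sfD: "sf f \<Longrightarrow> c \<in> A \<Longrightarrow> Cinf_on (coord c ` dom_of c) (\<lambda>x. f (param c x))"
  by (simp add: smooth_fun_def o_def)

lemma svD: "sv X \<Longrightarrow> c \<in> A \<Longrightarrow> Cinf_on (coord c ` dom_of c) (vf_rep A c X)"
  by (simp add: smooth_vf_def)

lemma sf_const [intro]: "sf (\<lambda>p. a)"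
  by (simp add: smooth_fun_def o_def Cinf_on_const)

lemma sf_add [intro]: "sf f \<Longrightarrow> sf h \<Longrightarrow> sf (\<lambda>p. f p + h p)"
  by (auto simp: smooth_fun_def o_def intro: Cinf_on_add open_coord)

lemma sf_mult [intro]: "sf f \<Longrightarrow> sf h \<Longrightarrow> sf (\<lambda>p. f p * h p)"
  by (auto simp: smooth_fun_def o_def intro: Cinf_on_mult open_coord)

lemma sf_minus [intro]: "sf f \<Longrightarrow> sf (\<lambda>p. - f p)"
  using sf_mult[OF sf_const[of "-1"]] by simp

lemma sv_add [intro]: "sv X \<Longrightarrow> sv Y \<Longrightarrow> sv (\<lambda>p. X p + Y p)"
  unfolding smooth_vf_def
  by (intro ballI Cinf_on_cong[THEN iffD1, OF open_coord vf_rep_lin(1)[symmetric]])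
    (auto intro: Cinf_on_add open_coord)

lemma sv_scale [intro]:
  assumes "sf f" "sv X" shows "sv (\<lambda>p. f p *\<^sub>R X p)"
  unfolding smooth_vf_def
  by (intro ballI Cinf_on_cong[THEN iffD1, OF open_coord vf_rep_lin(2)[symmetric]])
    (auto intro: Cinf_on_scaleR open_coord sfD[OF assms(1)] svD[OF assms(2)])

lemma sv_scale_const [intro]: "sv X \<Longrightarrow> sv (\<lambda>p. a *\<^sub>R X p)"
  by (rule sv_scale) auto

lemma sv_minus [intro]: "sv X \<Longrightarrow> sv (\<lambda>p. - X p)"
  using sv_scale_const[of X "-1"] by simp

lemma sv_diff [intro]: "sv X \<Longrightarrow> sv Y \<Longrightarrow> sv (\<lambda>p. X p - Y p)"
  using sv_add[OF _ sv_minus] by simp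

text \<open>A field may be divided by a smooth function near the points where the function does not
  vanish. This proves smoothness of a field that is only known through its multiples by varying
  functions.\<close>

lemma sv_divide:
  assumes "\<And>p. \<exists>f. sf f \<and> f p \<noteq> 0 \<and> sv (\<lambda>q. f q *\<^sub>R X q)"
  shows "sv X"
  unfolding smooth_vf_def
proof (intro ballI Cinf_on_local)
  fix c x assume c: "c \<in> A" and x: "x \<in> coord c ` dom_of c"
  obtain f where f: "sf f" "f (param c x) \<noteq> 0" "sv (\<lambda>q. f q *\<^sub>R X q)"
    using assms by blast
  let ?S = "coord c ` dom_of c"
  let ?h = "\<lambda>x. f (param c x)"
  let ?U = "?S \<inter> ?h -` (- {0})"
  have "continuous_on ?S ?h"
    using sfD[OF f(1) c] unfolding Cinf_on_def by (metis Ck_on.simps(1))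
  then have U: "open ?U"
    using continuous_open_preimage open_coord[OF c] by blast
  have "Cinf_on ?U (\<lambda>y. inverse (?h y) *\<^sub>R vf_rep A c (\<lambda>q. f q *\<^sub>R X q) y)"
    by (intro Cinf_on_scaleR Cinf_on_inverse U Cinf_on_subset[OF sfD[OF f(1) c]]
        Cinf_on_subset[OF svD[OF f(3) c]]) auto
  moreover have "inverse (?h y) *\<^sub>R vf_rep A c (\<lambda>q. f q *\<^sub>R X q) y = vf_rep A c X y" if "y \<in> ?U" for y
    using that vf_rep_lin(2)[OF c, of y f X] by auto
  ultimately have "Cinf_on ?U (vf_rep A c X)"
    using Cinf_on_cong[OF U] by (metis (no_types, lifting))
  then show "\<exists>U. open U \<and> x \<in> U \<and> Cinf_on U (vf_rep A c X)"
    using U x f(2) by blast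
qed

text \<open>The derivative along a field is defined by a chart that changes from point to point; the
  chain rule replaces it by one fixed chart, which is what further differentiation requires.\<close>

lemma vf_deriv_chart:
  assumes "c \<in> A" "p \<in> dom_of c" "sf f"
  shows "vf_deriv A X f p
    = frechet_derivative (\<lambda>x. f (param c x)) (at (coord c p)) (vf_rep A c X (coord c p))"
proof -
  let ?d = "chart_at A p"
  have d: "?d \<in> A" "p \<in> dom_of ?d" by (auto simp: chart_at_mem chart_at_dom)
  let ?D = "\<lambda>c. frechet_derivative (\<lambda>x. f (param c x)) (at (coord c p))"
  have D: "((\<lambda>x. f (param c x)) has_derivative ?D c) (at (coord c (param ?d (coord ?d p))))"
    using Cinf_on_has_derivative[OF sfD[OF assms(3,1)]] assms(1,2) d by auto
  have 1: "((\<lambda>x. f (param c (coord c (param ?d x)))) has_derivative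
      (\<lambda>v. ?D c (coord_change ?d c p v))) (at (coord ?d p))"
    by (rule has_derivative_compose[OF trans_has_derivative[OF d(1) assms(1) d(2) assms(2)] D])
  have 2: "((\<lambda>x. f (param ?d x)) has_derivative (\<lambda>v. ?D c (coord_change ?d c p v))) (at (coord ?d p))"
    by (rule has_derivative_transform_within_open[OF 1 open_overlap[OF d(1) assms(1)]])
      (use assms d in auto)
  show ?thesis
    using fun_cong[OF frechet_derivative_at[OF 2], of "X p"] vf_rep_coord[OF assms(1,2), of X]
    by (simp add: vf_deriv_def o_def)
qed

lemma sf_vf_deriv [intro]:
  assumes "sv X" "sf f" shows "sf (vf_deriv A X f)"
  unfolding smooth_fun_def o_def
proof
  fix c assume c: "c \<in> A"
  have "Cinf_on (coord c ` dom_of c)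
    (\<lambda>x. frechet_derivative (\<lambda>x. f (param c x)) (at x) (vf_rep A c X x))"
    by (rule Cinf_on_deriv_field[OF open_coord[OF c] sfD[OF assms(2) c] svD[OF assms(1) c]])
  moreover have "frechet_derivative (\<lambda>x. f (param c x)) (at x) (vf_rep A c X x)
      = vf_deriv A X f (param c x)" if "x \<in> coord c ` dom_of c" for x
    using that vf_deriv_chart[OF c _ assms(2)] c by auto
  ultimately show "Cinf_on (coord c ` dom_of c) (\<lambda>x. vf_deriv A X f (param c x))"
    using Cinf_on_cong[OF open_coord[OF c]] by (metis (no_types, lifting))
qed

lemma sf_has_derivative:
  assumes "sf f"
  shows "((\<lambda>x. f (param (chart_at A p) x)) has_derivative
    frechet_derivative (f \<circ> param (chart_at A p)) (at (coord (chart_at A p) p)))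
    (at (coord (chart_at A p) p))"
  using Cinf_on_has_derivative[OF sfD[OF assms chart_at_mem]] chart_at_dom by (auto simp: o_def)

lemma vf_deriv_add:
  assumes "sf f" "sf h"
  shows "vf_deriv A X (\<lambda>q. f q + h q) p = vf_deriv A X f p + vf_deriv A X h p"
  using fun_cong[OF frechet_derivative_at[OF has_derivative_add[OF sf_has_derivative[OF assms(1)]
    sf_has_derivative[OF assms(2)]]], of p "X p"]
  by (simp add: vf_deriv_def o_def)

lemma vf_deriv_mult:
  assumes "sf f" "sf h"
  shows "vf_deriv A X (\<lambda>q. f q * h q) p = f p * vf_deriv A X h p + vf_deriv A X f p * h p"
  using fun_cong[OF frechet_derivative_at[OF has_derivative_mult[OF sf_has_derivative[OF assms(1)]
    sf_has_derivative[OF assms(2)]]], of p "X p"]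
  by (simp add: vf_deriv_def o_def chart_at_mem chart_at_dom)

lemma vf_deriv_const [simp]: "vf_deriv A X (\<lambda>q. a) p = 0"
  by (simp add: vf_deriv_def o_def)

lemma vf_deriv_cmult: "sf f \<Longrightarrow> vf_deriv A X (\<lambda>q. a * f q) p = a * vf_deriv A X f p"
  using vf_deriv_mult[of "\<lambda>q. a" f X p] by auto

lemma vf_deriv_minus: "sf f \<Longrightarrow> vf_deriv A X (\<lambda>q. - f q) p = - vf_deriv A X f p"
  using vf_deriv_cmult[of f X "-1" p] by simp

lemma vf_deriv_diff:
  assumes "sf f" "sf h"
  shows "vf_deriv A X (\<lambda>q. f q - h q) p = vf_deriv A X f p - vf_deriv A X h p"
  using vf_deriv_add[OF assms(1) sf_minus[OF assms(2)]] vf_deriv_minus[OF assms(2)] by simp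

lemma vf_deriv_vec:
  assumes "sf f"
  shows "vf_deriv A (\<lambda>q. X q + Y q) f p = vf_deriv A X f p + vf_deriv A Y f p"
    and "vf_deriv A (\<lambda>q. a q *\<^sub>R X q) f p = a p * vf_deriv A X f p"
    and "vf_deriv A (\<lambda>q. X q - Y q) f p = vf_deriv A X f p - vf_deriv A Y f p"
proof -
  have l: "linear (frechet_derivative (f \<circ> param (chart_at A p)) (at (coord (chart_at A p) p)))"
    using sf_has_derivative[OF assms] has_derivative_linear by blast
  show "vf_deriv A (\<lambda>q. X q + Y q) f p = vf_deriv A X f p + vf_deriv A Y f p"
    "vf_deriv A (\<lambda>q. a q *\<^sub>R X q) f p = a p * vf_deriv A X f p"
    "vf_deriv A (\<lambda>q. X q - Y q) f p = vf_deriv A X f p - vf_deriv A Y f p"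
    by (simp_all add: vf_deriv_def linear_add[OF l] linear_cmul[OF l] linear_diff[OF l])
qed

text \<open>The product rule for \<open>y \<mapsto> D\<phi>(y)(Y y)\<close>. Since only directional derivatives of \<open>D\<phi>\<close> are at
  hand, the vector \<open>Y y\<close> is expanded in a basis.\<close>

lemma Cinf_on_iterated_derivative:
  fixes \<phi> :: "real ^ 'k \<Rightarrow> real" and Y :: "real ^ 'k \<Rightarrow> real ^ 'k"
  assumes "open S" "x \<in> S" "Cinf_on S \<phi>" "Cinf_on S Y"
  shows "frechet_derivative (\<lambda>y. frechet_derivative \<phi> (at y) (Y y)) (at x) v
    = frechet_derivative (\<lambda>y. frechet_derivative \<phi> (at y) (Y x)) (at x) v
      + frechet_derivative \<phi> (at x) (frechet_derivative Y (at x) v)"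
proof -
  let ?D = "\<lambda>y. frechet_derivative \<phi> (at y)"
  have l: "linear (?D y)" if "y \<in> S" for y
    using Cinf_on_has_derivative[OF assms(3) that] has_derivative_linear by blast
  have rep: "?D y w = (\<Sum>b\<in>Basis. (w \<bullet> b) * ?D y b)" if "y \<in> S" for y w
  proof -
    show ?thesis
      by (subst euclidean_representation[of "w", symmetric])
        (simp only: linear_sum[OF l[OF that]] linear_cmul[OF l[OF that]] real_scaleR_def)
  qed
  let ?E = "\<lambda>b. frechet_derivative (\<lambda>y. ?D y b) (at x)"
  have E: "((\<lambda>y. ?D y b) has_derivative ?E b) (at x)" for b
    by (rule Cinf_on_has_derivative[OF Cinf_on_deriv[OF assms(3)] assms(2)])
  have Y: "((\<lambda>y. Y y \<bullet> b) has_derivative (\<lambda>v. frechet_derivative Y (at x) v \<bullet> b)) (at x)" for b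
    by (rule has_derivative_inner_left[OF Cinf_on_has_derivative[OF assms(4,2)]])
  have 1: "((\<lambda>y. \<Sum>b\<in>Basis. (Y y \<bullet> b) * ?D y b) has_derivative
      (\<lambda>v. \<Sum>b\<in>Basis. (Y x \<bullet> b) * ?E b v + (frechet_derivative Y (at x) v \<bullet> b) * ?D x b)) (at x)"
    by (intro has_derivative_sum has_derivative_mult E Y)
  have 2: "((\<lambda>y. ?D y (Y y)) has_derivative
      (\<lambda>v. \<Sum>b\<in>Basis. (Y x \<bullet> b) * ?E b v + (frechet_derivative Y (at x) v \<bullet> b) * ?D x b)) (at x)"
    by (rule has_derivative_transform_within_open[OF 1 assms(1,2)]) (rule rep[symmetric])
  have 3: "((\<lambda>y. \<Sum>b\<in>Basis. (Y x \<bullet> b) * ?D y b) has_derivative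
      (\<lambda>v. \<Sum>b\<in>Basis. (Y x \<bullet> b) * ?E b v)) (at x)"
    by (intro has_derivative_sum has_derivative_mult_right E)
  have 4: "((\<lambda>y. ?D y (Y x)) has_derivative (\<lambda>v. \<Sum>b\<in>Basis. (Y x \<bullet> b) * ?E b v)) (at x)"
    by (rule has_derivative_transform_within_open[OF 3 assms(1,2)]) (rule rep[symmetric])
  show ?thesis
    by (simp add: frechet_derivative_at[OF 2, symmetric] frechet_derivative_at[OF 4, symmetric]
        sum.distrib flip: rep[OF assms(2)])
qed

text \<open>In the chart at \<open>p\<close> the terms with second derivatives of \<open>f\<close> are symmetric in the two
  fields and cancel.\<close>

lemma vf_deriv_bracket:
  assumes "sv X" "sv Y" "sf f"
  shows "vf_deriv A (bracket A X Y) f p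
    = vf_deriv A X (vf_deriv A Y f) p - vf_deriv A Y (vf_deriv A X f) p"
proof -
  let ?c = "chart_at A p"
  let ?S = "coord ?c ` dom_of ?c"
  let ?x = "coord ?c p"
  let ?f = "\<lambda>x. f (param ?c x)"
  have c: "?c \<in> A" "p \<in> dom_of ?c" by (auto simp: chart_at_mem chart_at_dom)
  have S: "open ?S" "?x \<in> ?S" using c open_coord by auto
  have F: "Cinf_on ?S ?f" by (rule sfD[OF assms(3) c(1)])
  have l: "linear (frechet_derivative ?f (at ?x))"
    using Cinf_on_has_derivative[OF F S(2)] has_derivative_linear by blast
  have *: "vf_deriv A X (vf_deriv A Y f) p =
      frechet_derivative (\<lambda>y. frechet_derivative ?f (at y) (Y p)) (at ?x) (X p)
      + frechet_derivative ?f (at ?x) (frechet_derivative (vf_rep A ?c Y) (at ?x) (X p))"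
    if "sv Y" for X Y
  proof -
    have "vf_deriv A X (vf_deriv A Y f) p
        = frechet_derivative (\<lambda>y. vf_deriv A Y f (param ?c y)) (at ?x) (X p)"
      by (simp add: vf_deriv_def o_def)
    also have "frechet_derivative (\<lambda>y. vf_deriv A Y f (param ?c y)) (at ?x)
        = frechet_derivative (\<lambda>y. frechet_derivative ?f (at y) (vf_rep A ?c Y y)) (at ?x)"
      by (rule frechet_derivative_cong_open[OF S]) (use vf_deriv_chart[OF c(1) _ assms(3)] c in auto)
    finally show ?thesis
      using Cinf_on_iterated_derivative[OF S F svD[OF that c(1)], of "X p"]
      by (simp add: vf_rep_chart_at)
  qed
  have "frechet_derivative (\<lambda>y. frechet_derivative ?f (at y) (Y p)) (at ?x) (X p)
    = frechet_derivative (\<lambda>y. frechet_derivative ?f (at y) (X p)) (at ?x) (Y p)"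
    by (rule second_derivative_symmetric[OF S]) (use F in \<open>simp add: Cinf_on_def del: Ck_on.simps\<close>)
  then show ?thesis
    using *[OF assms(2), of X] *[OF assms(1), of Y]
    by (simp add: vf_deriv_def bracket_def linear_diff[OF l] o_def)
qed

lemma chart_ball:
  assumes "c \<in> A" "p \<in> dom_of c"
  obtains r where "r > 0" "cball (coord c p) r \<subseteq> coord c ` dom_of c"
    "closed (param c ` cball (coord c p) r)" "param c ` cball (coord c p) r \<subseteq> dom_of c"
proof -
  obtain r where r: "r > 0" "cball (coord c p) r \<subseteq> coord c ` dom_of c"
    using open_coord[OF assms(1)] assms(2) open_contains_cball by blast
  have "compact (param c ` cball (coord c p) r)"
    using continuous_on_subset[OF homeomorphism_cont2[OF chart_homeo[OF assms(1)]] r(2)]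
    by (intro compact_continuous_image) auto
  then have "closed (param c ` cball (coord c p) r)" by (rule compact_imp_closed)
  moreover have "param c ` cball (coord c p) r \<subseteq> dom_of c" using r assms by force
  ultimately show ?thesis using that r by blast
qed

text \<open>A function or field that is given in one chart and has compact support there extends by zero:
  every point lies either in the chart or in the open complement of the support.\<close>

lemma Cinf_on_chart_cover:
  fixes H :: "real ^ 'n \<Rightarrow> 'v::real_normed_vector"
  assumes c: "c \<in> A" and d: "d \<in> A" and K: "closed K" "K \<subseteq> dom_of c"
    and h: "Cinf_on (coord d ` (dom_of d \<inter> dom_of c)) H"
    and 0: "\<And>q. q \<in> dom_of d \<Longrightarrow> q \<notin> K \<Longrightarrow> H (coord d q) = 0"
  shows "Cinf_on (coord d ` dom_of d) H"
proof (rule Cinf_on_local)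
  fix y assume "y \<in> coord d ` dom_of d"
  then obtain q where q: "q \<in> dom_of d" "y = coord d q" by blast
  show "\<exists>U. open U \<and> y \<in> U \<and> Cinf_on U H"
  proof (cases "q \<in> dom_of c")
    case True
    then show ?thesis using q h open_overlap[OF d c] by blast
  next
    case False
    let ?U = "coord d ` (dom_of d - K)"
    have U: "open ?U" using K open_dom[OF d] by (intro open_coord_image[OF d]) auto
    have "Cinf_on ?U H"
      using Cinf_on_cong[OF U, of H "\<lambda>x. 0"] 0 Cinf_on_const by blast
    then show ?thesis using U q False K by blast
  qed
qed

text \<open>The constant field \<open>v\<close> in the chart at \<open>p\<close>, cut off by a bump function. Through this lemma
  identities between fields become identities between tangent vectors.\<close>

lemma smooth_extension: "\<exists>X. sv X \<and> X p = v"
proof -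
  let ?c = "chart_at A p"
  have c: "?c \<in> A" "p \<in> dom_of ?c" by (auto simp: chart_at_mem chart_at_dom)
  obtain r where r: "r > 0" "cball (coord ?c p) r \<subseteq> coord ?c ` dom_of ?c"
    "closed (param ?c ` cball (coord ?c p) r)" "param ?c ` cball (coord ?c p) r \<subseteq> dom_of ?c"
    using chart_ball[OF c] .
  obtain \<phi> :: "real ^ 'n \<Rightarrow> real" where \<phi>: "Cinf_on UNIV \<phi>" "\<phi> (coord ?c p) = 1"
    "\<And>x. x \<notin> cball (coord ?c p) r \<Longrightarrow> \<phi> x = 0"
    using bump_function[OF r(1), of "coord ?c p"] by blast
  define X where "X q = (if q \<in> dom_of ?c
      then \<phi> (coord ?c q) *\<^sub>R coord_change ?c (chart_at A q) q v else 0)" for q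
  have "sv X" unfolding smooth_vf_def
  proof
    fix d assume d: "d \<in> A"
    show "Cinf_on (coord d ` dom_of d) (vf_rep A d X)"
    proof (rule Cinf_on_chart_cover[OF c(1) d r(3,4)])
      let ?O = "coord d ` (dom_of d \<inter> dom_of ?c)"
      have O: "open ?O" by (rule open_overlap[OF d c(1)])
      have "Cinf_on ?O (\<lambda>y. \<phi> (coord ?c (param d y)) *\<^sub>R
          frechet_derivative (\<lambda>x. coord d (param ?c x)) (at (coord ?c (param d y))) v)"
      proof (intro Cinf_on_scaleR[OF O])
        show "Cinf_on ?O (\<lambda>y. \<phi> (coord ?c (param d y)))"
          by (rule Cinf_on_compose[OF O open_UNIV _ trans_smooth[OF d c(1)] \<phi>(1)]) auto
        show "Cinf_on ?O (\<lambda>y. frechet_derivative (\<lambda>x. coord d (param ?c x)) (at (coord ?c (param d y))) v)"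
          by (rule Cinf_on_compose[OF O open_overlap[OF c(1) d] _ trans_smooth[OF d c(1)]
              Cinf_on_deriv[OF trans_smooth[OF c(1) d]]]) (use c d in auto)
      qed
      moreover have "\<phi> (coord ?c (param d y)) *\<^sub>R
          frechet_derivative (\<lambda>x. coord d (param ?c x)) (at (coord ?c (param d y))) v = vf_rep A d X y"
        if "y \<in> ?O" for y
      proof -
        from that obtain q where q: "q \<in> dom_of d" "q \<in> dom_of ?c" "y = coord d q" by blast
        have l: "linear (coord_change (chart_at A q) d q)"
          using d q by (intro coord_change_linear chart_at_mem chart_at_dom)
        show ?thesis
          using q d coord_change_compose[OF c(1) chart_at_mem[of q] d q(2) chart_at_dom q(1), of v]
          by (simp add: vf_rep_coord X_def linear_cmul[OF l]) (simp add: coord_change_def o_def)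
      qed
      ultimately show "Cinf_on ?O (vf_rep A d X)"
        using Cinf_on_cong[OF O] by (metis (no_types, lifting))
    next
      fix q assume q: "q \<in> dom_of d" "q \<notin> param ?c ` cball (coord ?c p) r"
      have "X q = 0"
      proof (cases "q \<in> dom_of ?c")
        case True
        then have "coord ?c q \<notin> cball (coord ?c p) r" using q(2) c(1) by (metis image_eqI param_coord)
        then show ?thesis using \<phi>(3) by (simp add: X_def)
      qed (simp add: X_def)
      then show "vf_rep A d X (coord d q) = 0"
        using linear_0[OF coord_change_linear[OF chart_at_mem d chart_at_dom q(1)]] d q
        by (simp add: vf_rep_coord)
    qed
  qed
  moreover have "X p = v" using c \<phi>(2) by (simp add: X_def coord_change_self)
  ultimately show ?thesis by blast
qed

text \<open>Functions separate tangent vectors: the coordinate functions of the chart at \<open>p\<close>, centred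
  at \<open>p\<close> and cut off by a bump function \<open>\<phi>\<close>, have the expected derivatives at \<open>p\<close>, because their
  own value there is \<open>0\<close> and \<open>\<phi>\<close> contributes only \<open>\<phi>(p) = 1\<close>.\<close>

lemma vf_eqI:
  assumes "\<And>f. sf f \<Longrightarrow> vf_deriv A X f p = vf_deriv A Y f p"
  shows "X p = Y p"
proof (rule euclidean_eqI)
  fix b :: "real ^ 'n" assume "b \<in> Basis"
  let ?c = "chart_at A p"
  let ?x = "coord ?c p"
  have c: "?c \<in> A" "p \<in> dom_of ?c" by (auto simp: chart_at_mem chart_at_dom)
  obtain r where r: "r > 0" "cball ?x r \<subseteq> coord ?c ` dom_of ?c"
    "closed (param ?c ` cball ?x r)" "param ?c ` cball ?x r \<subseteq> dom_of ?c"
    using chart_ball[OF c] .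
  obtain \<phi> :: "real ^ 'n \<Rightarrow> real" where \<phi>: "Cinf_on UNIV \<phi>" "\<phi> ?x = 1"
    "\<And>x. x \<notin> cball ?x r \<Longrightarrow> \<phi> x = 0"
    using bump_function[OF r(1), of ?x] by blast
  define h where "h x = \<phi> x * ((x + - ?x) \<bullet> b)" for x
  have h: "Cinf_on UNIV h" unfolding h_def
    by (intro Cinf_on_mult Cinf_on_bounded_linear[OF bounded_linear_inner_left]
        Cinf_on_add Cinf_on_id Cinf_on_const \<phi>(1) open_UNIV)
  define f where "f q = (if q \<in> dom_of ?c then h (coord ?c q) else 0)" for q
  have "sf f" unfolding smooth_fun_def o_def
  proof
    fix d assume d: "d \<in> A"
    show "Cinf_on (coord d ` dom_of d) (\<lambda>x. f (param d x))"
    proof (rule Cinf_on_chart_cover[OF c(1) d r(3,4)])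
      let ?O = "coord d ` (dom_of d \<inter> dom_of ?c)"
      have O: "open ?O" by (rule open_overlap[OF d c(1)])
      have "Cinf_on ?O (\<lambda>y. h (coord ?c (param d y)))"
        by (rule Cinf_on_compose[OF O open_UNIV _ trans_smooth[OF d c(1)] h]) auto
      then show "Cinf_on ?O (\<lambda>x. f (param d x))"
        by (rule Cinf_on_cong[OF O, THEN iffD1, rotated]) (use d in \<open>auto simp: f_def\<close>)
    next
      fix q assume q: "q \<in> dom_of d" "q \<notin> param ?c ` cball ?x r"
      show "f (param d (coord d q)) = 0"
      proof (cases "q \<in> dom_of ?c")
        case True
        then have "coord ?c q \<notin> cball ?x r" using q(2) c(1) by (metis image_eqI param_coord)
        then show ?thesis using \<phi>(3) d q by (simp add: f_def h_def)
      qed (use d q in \<open>simp add: f_def\<close>)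
    qed
  qed
  have "(h has_derivative (\<lambda>w. w \<bullet> b)) (at ?x)"
  proof -
    have "(h has_derivative (\<lambda>w. \<phi> ?x * ((w + 0) \<bullet> b) + frechet_derivative \<phi> (at ?x) w * ((?x + - ?x) \<bullet> b))) (at ?x)"
      unfolding h_def
      by (intro has_derivative_mult has_derivative_inner_left has_derivative_add has_derivative_ident
          has_derivative_const Cinf_on_has_derivative[OF \<phi>(1)] UNIV_I)
    then show ?thesis using \<phi>(2) by simp
  qed
  then have "((\<lambda>x. f (param ?c x)) has_derivative (\<lambda>w. w \<bullet> b)) (at ?x)"
    by (rule has_derivative_transform_within_open[OF _ open_coord[OF c(1)]])
      (use c in \<open>auto simp: f_def\<close>)
  then have "vf_deriv A Z f p = Z p \<bullet> b" for Z
    by (simp add: vf_deriv_def o_def frechet_derivative_at[symmetric])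
  then show "X p \<bullet> b = Y p \<bullet> b" using assms[OF \<open>sf f\<close>] by simp
qed

end

section \<open>Linear connections, exterior derivatives and curvature\<close>

context smooth_mfd
begin

lemma conn_sv: "linear_connection A D \<Longrightarrow> sv X \<Longrightarrow> sv Y \<Longrightarrow> sv (D X Y)"
  by (simp add: linear_connection_def)

lemma conn_add1: "linear_connection A D \<Longrightarrow> sv X \<Longrightarrow> sv Y \<Longrightarrow> sv Z \<Longrightarrow>
    D (\<lambda>p. X p + Y p) Z = (\<lambda>p. D X Z p + D Y Z p)"
  by (simp add: linear_connection_def)

lemma conn_add2: "linear_connection A D \<Longrightarrow> sv X \<Longrightarrow> sv Y \<Longrightarrow> sv Z \<Longrightarrow>
    D X (\<lambda>p. Y p + Z p) = (\<lambda>p. D X Y p + D X Z p)"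
  by (simp add: linear_connection_def)

lemma conn_scale1: "linear_connection A D \<Longrightarrow> sf f \<Longrightarrow> sv X \<Longrightarrow> sv Y \<Longrightarrow>
    D (\<lambda>p. f p *\<^sub>R X p) Y = (\<lambda>p. f p *\<^sub>R D X Y p)"
  by (simp add: linear_connection_def)

lemma conn_scale2: "linear_connection A D \<Longrightarrow> sf f \<Longrightarrow> sv X \<Longrightarrow> sv Y \<Longrightarrow>
    D X (\<lambda>p. f p *\<^sub>R Y p) = (\<lambda>p. vf_deriv A X f p *\<^sub>R Y p + f p *\<^sub>R D X Y p)"
  by (simp add: linear_connection_def)

lemma conn_minus:
  assumes "linear_connection A D" "sv X" "sv Y"
  shows "D (\<lambda>p. - X p) Y = (\<lambda>p. - D X Y p)" "D X (\<lambda>p. - Y p) = (\<lambda>p. - D X Y p)"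
  using conn_scale1[OF assms(1) sf_const[of "-1"] assms(2,3)]
    conn_scale2[OF assms(1) sf_const[of "-1"] assms(2,3)] by simp_all

lemma conn_diff1:
  assumes "linear_connection A D" "sv X" "sv Y" "sv Z"
  shows "D (\<lambda>p. X p - Y p) Z = (\<lambda>p. D X Z p - D Y Z p)"
  using conn_add1[OF assms(1,2) sv_minus[OF assms(3)] assms(4)]
    conn_minus(1)[OF assms(1,3,4)] by simp

lemma conn_diff2:
  assumes "linear_connection A D" "sv X" "sv Y" "sv Z"
  shows "D X (\<lambda>p. Y p - Z p) = (\<lambda>p. D X Y p - D X Z p)"
  using conn_add2[OF assms(1,2,3) sv_minus[OF assms(4)]]
    conn_minus(2)[OF assms(1,2,4)] by simp

end

definition ext_d ::
    "('m, 'n::finite) chart set \<Rightarrow> ('m \<Rightarrow> real ^ 'n \<Rightarrow> real) \<Rightarrow>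
     ('m \<Rightarrow> real ^ 'n) \<Rightarrow> ('m \<Rightarrow> real ^ 'n) \<Rightarrow> 'm \<Rightarrow> real" where
  "ext_d A \<theta> X Y p = vf_deriv A X (\<lambda>q. \<theta> q (Y q)) p - vf_deriv A Y (\<lambda>q. \<theta> q (X q)) p
     - \<theta> p (bracket A X Y p)"

lemma closed_form_iff:
  "closed_form A \<theta> \<longleftrightarrow> (\<forall>X Y p. smooth_vf A X \<longrightarrow> smooth_vf A Y \<longrightarrow> ext_d A \<theta> X Y p = 0)"
  by (simp add: closed_form_def ext_d_def)

locale riem_mfd = smooth_mfd A
  for A :: "('m::{t2_space,second_countable_topology}, 'n::finite) chart set" +
  fixes g :: "'m \<Rightarrow> real ^ 'n \<Rightarrow> real ^ 'n \<Rightarrow> real" and nabla :: "('m, 'n) connection"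
  assumes metric: "riemannian_metric A g" and LC: "levi_civita A g nabla"
begin

lemma g_sym: "g p u v = g p v u"
  and g_pos: "u \<noteq> 0 \<Longrightarrow> g p u u > 0"
  and sf_g: "sv X \<Longrightarrow> sv Y \<Longrightarrow> sf (\<lambda>p. g p (X p) (Y p))"
  using metric unfolding riemannian_metric_def by auto

lemma g_bilin: "bilinear (g p)"
  using metric unfolding riemannian_metric_def by auto

lemma g_simps [simp]:
  "g p (u + v) w = g p u w + g p v w" "g p w (u + v) = g p w u + g p w v"
  "g p (a *\<^sub>R u) w = a * g p u w" "g p w (a *\<^sub>R u) = a * g p w u"
  "g p (- u) w = - g p u w" "g p w (- u) = - g p w u"
  "g p (u - v) w = g p u w - g p v w" "g p w (u - v) = g p w u - g p w v"
  "g p 0 w = 0" "g p w 0 = 0"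
proof -
  have l: "linear (\<lambda>v. g p v w)" "linear (g p w)" for w
    using g_bilin[of p] by (auto simp: bilinear_def)
  note r = linear_add linear_cmul linear_neg linear_diff linear_0
  show "g p (u + v) w = g p u w + g p v w" "g p w (u + v) = g p w u + g p w v"
    "g p (a *\<^sub>R u) w = a * g p u w" "g p w (a *\<^sub>R u) = a * g p w u"
    "g p (- u) w = - g p u w" "g p w (- u) = - g p w u"
    "g p (u - v) w = g p u w - g p v w" "g p w (u - v) = g p w u - g p w v"
    "g p 0 w = 0" "g p w 0 = 0"
    using r[OF l(1)] r[OF l(2)] by auto
qed

lemma g_eqI:
  assumes "\<And>w. g p u w = g p v w" shows "u = v"
proof (rule ccontr)
  assume "u \<noteq> v"
  then have "g p (u - v) (u - v) > 0" by (intro g_pos) simp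
  with assms show False by simp
qed

lemma nabla_conn: "linear_connection A nabla"
  using LC by (simp add: levi_civita_def)

lemma bracket_eq: "sv X \<Longrightarrow> sv Y \<Longrightarrow> bracket A X Y p = nabla X Y p - nabla Y X p"
  using LC by (simp add: levi_civita_def)

lemma nabla_metric: "sv X \<Longrightarrow> sv Y \<Longrightarrow> sv Z \<Longrightarrow>
    vf_deriv A X (\<lambda>q. g q (Y q) (Z q)) p = g p (nabla X Y p) (Z p) + g p (Y p) (nabla X Z p)"
  using LC by (simp add: levi_civita_def)

text \<open>Since \<open>\<nabla>\<close> is torsion-free, brackets inherit smoothness, additivity and the Leibniz rule
  from the axioms of a connection, which avoids computing in charts.\<close>

lemma sv_bracket [intro]: assumes "sv X" "sv Y" shows "sv (bracket A X Y)"
proof -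
  have "bracket A X Y = (\<lambda>p. nabla X Y p - nabla Y X p)" using bracket_eq assms by auto
  then show ?thesis using conn_sv[OF nabla_conn] assms by auto
qed

lemma bracket_anti: "bracket A X Y p = - bracket A Y X p"
  by (simp add: bracket_def)

lemma bracket_anti': "bracket A X Y = (\<lambda>p. - bracket A Y X p)"
  by (auto simp: bracket_def)

lemma bracket_add: assumes "sv X" "sv Y" "sv Z"
  shows "bracket A (\<lambda>p. X p + Y p) Z = (\<lambda>p. bracket A X Z p + bracket A Y Z p)"
  using assms by (auto simp: bracket_eq sv_add conn_add1[OF nabla_conn] conn_add2[OF nabla_conn])

lemma bracket_scale: assumes "sf f" "sv X" "sv Y"
  shows "bracket A (\<lambda>p. f p *\<^sub>R X p) Y = (\<lambda>p. f p *\<^sub>R bracket A X Y p - vf_deriv A Y f p *\<^sub>R X p)"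
  using assms by (auto simp: bracket_eq sv_scale conn_scale1[OF nabla_conn] conn_scale2[OF nabla_conn]
    algebra_simps)

text \<open>Both sides are compared as derivations: the third derivatives of a function cancel in
  pairs.\<close>

lemma jacobi:
  assumes "sv X" "sv Y" "sv Z"
  shows "bracket A X (bracket A Y Z) p + bracket A Y (bracket A Z X) p + bracket A Z (bracket A X Y) p = 0"
proof -
  have "(\<lambda>p. bracket A X (bracket A Y Z) p + bracket A Y (bracket A Z X) p + bracket A Z (bracket A X Y) p) p
    = (\<lambda>p. 0) p"
  proof (rule vf_eqI)
    fix f assume f: "sf f"
    have 1: "vf_deriv A X (vf_deriv A (bracket A Y Z) f) p
        = vf_deriv A X (vf_deriv A Y (vf_deriv A Z f)) p - vf_deriv A X (vf_deriv A Z (vf_deriv A Y f)) p"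
      if "sv X" "sv Y" "sv Z" for X Y Z
    proof -
      have "vf_deriv A (bracket A Y Z) f = (\<lambda>q. vf_deriv A Y (vf_deriv A Z f) q - vf_deriv A Z (vf_deriv A Y f) q)"
        using vf_deriv_bracket[OF that(2,3) f] by blast
      then show ?thesis
        using vf_deriv_diff[OF sf_vf_deriv[OF that(2) sf_vf_deriv[OF that(3) f]]
          sf_vf_deriv[OF that(3) sf_vf_deriv[OF that(2) f]]] by simp
    qed
    have 2: "vf_deriv A (bracket A X (bracket A Y Z)) f p
        = vf_deriv A X (vf_deriv A Y (vf_deriv A Z f)) p - vf_deriv A X (vf_deriv A Z (vf_deriv A Y f)) p
        - (vf_deriv A Y (vf_deriv A Z (vf_deriv A X f)) p - vf_deriv A Z (vf_deriv A Y (vf_deriv A X f)) p)"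
      if "sv X" "sv Y" "sv Z" for X Y Z
      using vf_deriv_bracket[OF that(1) sv_bracket[OF that(2,3)] f] 1[OF that]
        vf_deriv_bracket[OF that(2,3) sf_vf_deriv[OF that(1) f]] by simp
    have z: "vf_deriv A (\<lambda>p. 0) f p = 0" using vf_deriv_vec(2)[OF f, of "\<lambda>p. 0" X p] by simp
    show "vf_deriv A (\<lambda>p. bracket A X (bracket A Y Z) p + bracket A Y (bracket A Z X) p + bracket A Z (bracket A X Y) p) f p
        = vf_deriv A (\<lambda>p. 0) f p"
      using 2[OF assms] 2[OF assms(2,3,1)] 2[OF assms(3,1,2)] by (simp add: vf_deriv_vec[OF f] z)
  qed
  then show ?thesis by simp
qed

lemma curvature_anti:
  assumes "linear_connection A D" "sv X" "sv Y" "sv Z"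
  shows "curvature A D X Y Z p = - curvature A D Y X Z p"
  using conn_minus(1)[OF assms(1) sv_bracket[OF assms(2,3)] assms(4)]
  by (simp add: curvature_def bracket_anti'[of Y X])

lemma sv_curvature:
  assumes D: "linear_connection A D" and "sv X" "sv Y" "sv Z"
  shows "sv (curvature A D X Y Z)"
proof -
  have "sv (\<lambda>p. D X (D Y Z) p - D Y (D X Z) p - D (bracket A X Y) Z p)"
    by (intro sv_diff conn_sv[OF D] sv_bracket assms)
  then show ?thesis by (simp add: curvature_def[abs_def])
qed

lemma curvature_add:
  assumes D: "linear_connection A D" and v: "sv X" "sv Y" "sv Z" "sv W"
  shows "curvature A D (\<lambda>p. X p + W p) Y Z p = curvature A D X Y Z p + curvature A D W Y Z p"
    and "curvature A D X Y (\<lambda>p. Z p + W p) p = curvature A D X Y Z p + curvature A D X Y W p"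
  using v by (simp_all add: curvature_def bracket_add conn_add1[OF D] conn_add2[OF D] conn_sv[OF D]
      sv_bracket sv_add)

lemma curvature_scale:
  assumes D: "linear_connection A D" and v: "sv X" "sv Y" "sv Z" and f: "sf f"
  shows "curvature A D (\<lambda>p. f p *\<^sub>R X p) Y Z p = f p *\<^sub>R curvature A D X Y Z p"
    and "curvature A D X Y (\<lambda>p. f p *\<^sub>R Z p) p = f p *\<^sub>R curvature A D X Y Z p"
  using v f
  by (simp_all add: vf_deriv_bracket[OF v(1,2) f] curvature_def bracket_scale conn_scale1[OF D] conn_scale2[OF D] conn_sv[OF D]
      conn_diff1[OF D] conn_add2[OF D] sv_bracket sv_scale sf_vf_deriv algebra_simps)

lemma curvature_tensor04:
  assumes D: "linear_connection A D"
  shows "tensor04 A (curvature04 A g D)"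
  unfolding tensor04_def Cinf_linear_def
proof (intro allI impI conjI)
  fix X Y Z W V f
  assume v: "sv X" "sv Y" "sv Z" "sv W"
  show "sf (curvature04 A g D W X Y Z)" "sf (curvature04 A g D X W Y Z)"
    "sf (curvature04 A g D X Y W Z)" "sf (curvature04 A g D X Y Z W)"
    unfolding curvature04_def[abs_def] by (intro sf_g sv_curvature D v)+
  {
    assume V: "sv V"
    show "curvature04 A g D (\<lambda>p. W p + V p) X Y Z
        = (\<lambda>p. curvature04 A g D W X Y Z p + curvature04 A g D V X Y Z p)"
      "curvature04 A g D X (\<lambda>p. W p + V p) Y Z
        = (\<lambda>p. curvature04 A g D X W Y Z p + curvature04 A g D X V Y Z p)"
      "curvature04 A g D X Y (\<lambda>p. W p + V p) Z
        = (\<lambda>p. curvature04 A g D X Y W Z p + curvature04 A g D X Y V Z p)"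
      "curvature04 A g D X Y Z (\<lambda>p. W p + V p)
        = (\<lambda>p. curvature04 A g D X Y Z W p + curvature04 A g D X Y Z V p)"
      using v V by (auto simp: curvature04_def curvature_add[OF D]
        curvature_anti[OF D, of X] sv_add)
  }
next
  fix X Y Z W f
  assume v: "sv X" "sv Y" "sv Z" "sv W" and f: "sf f"
  show "curvature04 A g D (\<lambda>p. f p *\<^sub>R W p) X Y Z = (\<lambda>p. f p * curvature04 A g D W X Y Z p)"
    "curvature04 A g D X (\<lambda>p. f p *\<^sub>R W p) Y Z = (\<lambda>p. f p * curvature04 A g D X W Y Z p)"
    "curvature04 A g D X Y (\<lambda>p. f p *\<^sub>R W p) Z = (\<lambda>p. f p * curvature04 A g D X Y W Z p)"
    "curvature04 A g D X Y Z (\<lambda>p. f p *\<^sub>R W p) = (\<lambda>p. f p * curvature04 A g D X Y Z W p)"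
    using v f by (auto simp: curvature04_def curvature_scale[OF D]
      curvature_anti[OF D, of X] sv_scale)
qed

text \<open>The commutator of derivations \<open>XY - YX - [X,Y]\<close> annihilates the function \<open>g(Z,W)\<close>;
  expanding it by metric compatibility leaves exactly the two curvature terms.\<close>

lemma curvature_skew:
  assumes D: "linear_connection A D"
    and Dg: "\<And>X Y Z p. sv X \<Longrightarrow> sv Y \<Longrightarrow> sv Z \<Longrightarrow>
      vf_deriv A X (\<lambda>q. g q (Y q) (Z q)) p = g p (D X Y p) (Z p) + g p (Y p) (D X Z p)"
    and v: "sv X" "sv Y" "sv Z" "sv W"
  shows "g p (curvature A D X Y Z p) (W p) = - g p (Z p) (curvature A D X Y W p)"
proof -
  have 1: "vf_deriv A X (vf_deriv A Y (\<lambda>q. g q (Z q) (W q))) p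
      = g p (D X (D Y Z) p) (W p) + g p (D Y Z p) (D X W p)
        + (g p (D X Z p) (D Y W p) + g p (Z p) (D X (D Y W) p))"
    if "sv X" "sv Y" for X Y
  proof -
    have "vf_deriv A Y (\<lambda>q. g q (Z q) (W q)) = (\<lambda>p. g p (D Y Z p) (W p) + g p (Z p) (D Y W p))"
      using Dg that v by blast
    then show ?thesis
      using that v by (simp add: vf_deriv_add sf_g conn_sv[OF D] Dg)
  qed
  show ?thesis
    using 1[OF v(1,2)] 1[OF v(2,1)] vf_deriv_bracket[OF v(1,2) sf_g[OF v(3,4)], of p]
      Dg[OF sv_bracket[OF v(1,2)] v(3,4), of p]
    by (simp add: curvature_def)
qed

text \<open>The Jacobi identity turns the cyclic sum of the curvature into a cyclic sum of terms with the
  torsion \<open>T\<close>. Inserting the special form of \<open>T\<close>, the derivatives of \<open>\<alpha>\<close> and \<open>\<beta>\<close> combine to \<open>d\<alpha>\<close> and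
  \<open>d\<beta>\<close>, while the expressions quadratic in \<open>\<alpha>\<close> and \<open>\<beta>\<close> cancel.\<close>

lemma first_bianchi:
  assumes D: "linear_connection A D"
    and P: "\<And>p. linear (P p)" "\<And>X. sv X \<Longrightarrow> sv (\<lambda>q. P q (X q))"
      "\<And>X Y p. sv X \<Longrightarrow> sv Y \<Longrightarrow> D X (\<lambda>q. P q (Y q)) p = P p (D X Y p)"
    and a: "\<And>p. linear (\<alpha> p)" "\<And>X. sv X \<Longrightarrow> sf (\<lambda>q. \<alpha> q (X q))"
    and b: "\<And>p. linear (\<beta> p)" "\<And>X. sv X \<Longrightarrow> sf (\<lambda>q. \<beta> q (X q))"
    and T: "\<And>X Y p. sv X \<Longrightarrow> sv Y \<Longrightarrow> D X Y p - D Y X p = bracket A X Y p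
      + (\<alpha> p (X p) *\<^sub>R P p (Y p) - \<alpha> p (Y p) *\<^sub>R P p (X p) + \<beta> p (X p) *\<^sub>R Y p - \<beta> p (Y p) *\<^sub>R X p)"
    and v: "sv X" "sv Y" "sv Z"
    and PP: "\<And>p u. P p (P p u) = u"
  shows "curvature A D X Y Z p + curvature A D Y Z X p + curvature A D Z X Y p
    = (ext_d A \<alpha> X Y p *\<^sub>R P p (Z p) + ext_d A \<beta> X Y p *\<^sub>R Z p)
    + (ext_d A \<alpha> Y Z p *\<^sub>R P p (X p) + ext_d A \<beta> Y Z p *\<^sub>R X p)
    + (ext_d A \<alpha> Z X p *\<^sub>R P p (Y p) + ext_d A \<beta> Z X p *\<^sub>R Y p)"
proof -
  let ?T = "\<lambda>X Y p. \<alpha> p (X p) *\<^sub>R P p (Y p) - \<alpha> p (Y p) *\<^sub>R P p (X p) + \<beta> p (X p) *\<^sub>R Y p - \<beta> p (Y p) *\<^sub>R X p"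
  note Pl = linear_add[OF P(1)] linear_diff[OF P(1)] linear_cmul[OF P(1)]
  note al = linear_add[OF a(1)] linear_diff[OF a(1)] linear_cmul[OF a(1)]
  note bl = linear_add[OF b(1)] linear_diff[OF b(1)] linear_cmul[OF b(1)]
  \<comment> \<open>\<open>D\<^sub>X (D\<^sub>Y Z - D\<^sub>Z Y)\<close>, grouped so that the cyclic sum of the curvature becomes a sum of
    torsion terms.\<close>
  have 1: "D X (D Y Z) p - D X (D Z Y) p = D X (bracket A Y Z) p
      + (vf_deriv A X (\<lambda>q. \<alpha> q (Y q)) p *\<^sub>R P p (Z p) + \<alpha> p (Y p) *\<^sub>R P p (D X Z p)
       - (vf_deriv A X (\<lambda>q. \<alpha> q (Z q)) p *\<^sub>R P p (Y p) + \<alpha> p (Z p) *\<^sub>R P p (D X Y p))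
       + (vf_deriv A X (\<lambda>q. \<beta> q (Y q)) p *\<^sub>R Z p + \<beta> p (Y p) *\<^sub>R D X Z p)
       - (vf_deriv A X (\<lambda>q. \<beta> q (Z q)) p *\<^sub>R Y p + \<beta> p (Z p) *\<^sub>R D X Y p))"
    if v: "sv X" "sv Y" "sv Z" for X Y Z
  proof -
    have "D X (D Y Z) p - D X (D Z Y) p = D X (\<lambda>q. D Y Z q - D Z Y q) p"
      using v by (simp add: conn_diff2[OF D] conn_sv[OF D])
    also have "(\<lambda>q. D Y Z q - D Z Y q) = (\<lambda>q. bracket A Y Z q + ?T Y Z q)"
      using T v by blast
    finally show ?thesis
      using v a(2) b(2) P(2)
      by (simp add: conn_add2[OF D] conn_diff2[OF D] conn_scale2[OF D] sv_bracket sv_add sv_diff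
          sv_scale P(3))
  qed
  have 2: "D X (bracket A Y Z) p - D (bracket A Y Z) X p = bracket A X (bracket A Y Z) p + ?T X (bracket A Y Z) p"
    if "sv X" "sv Y" "sv Z" for X Y Z
    using T[OF that(1) sv_bracket[OF that(2,3)]] .
  have 3: "curvature A D X Y Z p + curvature A D Y Z X p + curvature A D Z X Y p
     = (D X (D Y Z) p - D X (D Z Y) p) + (D Y (D Z X) p - D Y (D X Z) p) + (D Z (D X Y) p - D Z (D Y X) p)
      - D (bracket A X Y) Z p - D (bracket A Y Z) X p - D (bracket A Z X) Y p"
    by (simp add: curvature_def)
  have 4: "curvature A D X Y Z p + curvature A D Y Z X p + curvature A D Z X Y p
     = (D X (D Y Z) p - D X (D Z Y) p - D X (bracket A Y Z) p)
     + (D Y (D Z X) p - D Y (D X Z) p - D Y (bracket A Z X) p)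
     + (D Z (D X Y) p - D Z (D Y X) p - D Z (bracket A X Y) p)
     + ?T X (bracket A Y Z) p + ?T Y (bracket A Z X) p + ?T Z (bracket A X Y) p"
  proof -
    have d: "D (bracket A Y Z) X p = D X (bracket A Y Z) p - bracket A X (bracket A Y Z) p - ?T X (bracket A Y Z) p"
      if "sv X" "sv Y" "sv Z" for X Y Z
      using 2[OF that] by (simp add: algebra_simps)
    have j: "bracket A Z (bracket A X Y) p = - bracket A X (bracket A Y Z) p - bracket A Y (bracket A Z X) p"
      using jacobi[OF v, of p] by (simp add: eq_neg_iff_add_eq_0 algebra_simps)
    show ?thesis
      unfolding 3 d[OF v] d[OF v(2,3,1)] d[OF v(3,1,2)] j by simp
  qed
  have t: "D Y X p = D X Y p - bracket A X Y p - ?T X Y p" "D Z Y p = D Y Z p - bracket A Y Z p - ?T Y Z p"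
    "D X Z p = D Z X p - bracket A Z X p - ?T Z X p"
    using T[OF v(1,2), of p] T[OF v(2,3), of p] T[OF v(3,1), of p]
    by (simp_all add: algebra_simps)
  show ?thesis
    unfolding 4 1[OF v] 1[OF v(2,3,1)] 1[OF v(3,1,2)] ext_d_def t
    by (simp add: Pl al bl PP algebra_simps)
qed

end

section \<open>Eigenspaces, Lee form and dual vector field on a W1-manifold\<close>

text \<open>Each eigenspace of a traceless involution has half the dimension. If a linear functional
  had no nonzero zero in the eigenspace of \<open>s\<close>, this eigenspace would be at most a line, and the
  trace of twice its projection \<open>Q = 1 + s P\<close>, which equals the dimension of the whole space,
  would be at most \<open>2\<close>.\<close>

lemma involution_eigenvector:
  fixes P :: "real ^ 'n \<Rightarrow> real ^ 'n" and f :: "real ^ 'n \<Rightarrow> real"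
  assumes P: "linear P" "\<And>u. P (P u) = u" "trace (matrix P) = 0" and N: "CARD('n) > 2"
    and s: "s = 1 \<or> s = - 1" and f: "linear f"
  shows "\<exists>z. z \<noteq> 0 \<and> P z = s *\<^sub>R z \<and> f z = 0"
proof (rule ccontr)
  assume "\<not> ?thesis"
  then have no: "z = 0" if "P z = s *\<^sub>R z" "f z = 0" for z using that by blast
  define Q where "Q v = v + s *\<^sub>R P v" for v
  note P_simps = linear_add[OF P(1)] linear_cmul[OF P(1)] linear_diff[OF P(1)]
  note fl = linear_add[OF f] linear_cmul[OF f] linear_diff[OF f]
  have ss: "s * s = 1" using s by auto
  have PQ: "P (Q v) = s *\<^sub>R Q v" for v
    using ss by (simp add: Q_def P_simps P(2) algebra_simps)
  have Ql: "linear Q"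
    by (rule linearI) (auto simp: Q_def P_simps algebra_simps)
  \<comment> \<open>The projection \<open>Q / 2\<close> onto the eigenspace would have rank at most one.\<close>
  obtain c w where c: "linear c" "\<And>v. Q v = c v *\<^sub>R w" "c w = 2 \<or> c w = (0::real)"
  proof (cases "\<exists>v. Q v \<noteq> 0")
    case True
    then obtain v0 where v0: "Q v0 \<noteq> 0" by blast
    define w where "w = Q v0"
    have fw: "f w \<noteq> 0" using no[OF PQ[of v0]] v0 by (auto simp: w_def)
    have "Q v - (f (Q v) / f w) *\<^sub>R w = 0" for v
      by (rule no) (use fw in \<open>simp_all add: w_def P_simps PQ fl algebra_simps\<close>)
    then have 1: "Q v = (f (Q v) / f w) *\<^sub>R w" for v by simp
    have "Q w = 2 *\<^sub>R w" using PQ[of v0] ss by (simp add: Q_def[of w]) (simp add: w_def scaleR_2)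
    then have 2: "f (Q w) / f w = 2" using fw by (simp add: fl)
    have "linear (\<lambda>v. f (Q v) / f w)"
      by (rule linearI) (auto simp: linear_add[OF Ql] linear_cmul[OF Ql] fl add_divide_distrib)
    with 1 2 show ?thesis using that by blast
  next
    case False
    then show ?thesis using that[of "\<lambda>v. 0" 0] by (auto simp: linear_zero)
  qed
  have "(\<Sum>i\<in>UNIV. Q (axis i 1) $ i) = real CARD('n) + s * (\<Sum>i\<in>UNIV. P (axis i 1) $ i)"
    by (simp add: Q_def sum.distrib sum_distrib_left axis_def)
  also have "(\<Sum>i\<in>UNIV. P (axis i 1) $ i) = 0"
    using P(3) by (simp add: trace_def matrix_def)
  finally have "real CARD('n) = (\<Sum>i\<in>UNIV. c (axis i 1) * w $ i)" using c(2) by simp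
  also have "\<dots> = c (\<Sum>i\<in>UNIV. w $ i *\<^sub>R axis i 1)"
    by (simp add: linear_sum[OF c(1)] linear_cmul[OF c(1)] mult.commute)
  also have "(\<Sum>i\<in>UNIV. w $ i *\<^sub>R axis i 1) = w"
    using basis_expansion[of w] by (simp add: scalar_mult_eq_scaleR)
  finally show False using c(3) N by auto
qed

locale w1_mfd = riem_mfd A g nabla
  for A :: "('m::{t2_space,second_countable_topology}, 'n::finite) chart set"
    and g and nabla :: "('m, 'n) connection" +
  fixes P :: "'m \<Rightarrow> real ^ 'n \<Rightarrow> real ^ 'n" and n :: nat
  assumes dim: "CARD('n) = 2 * n" "n \<ge> 2"
    and RAP: "riemannian_almost_product A P g"
    and W1: "W1_manifold A P g nabla n"
begin

abbreviation lee where "lee \<equiv> lee_form A P g nabla"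
abbreviation Omega where "Omega \<equiv> dual_vector g lee"
abbreviation k where "k \<equiv> 1 / (2 * real n)"

lemma k_pos: "k > 0" using dim by simp

lemma P_linear: "linear (P p)" and P_sv [intro]: "sv X \<Longrightarrow> sv (\<lambda>p. P p (X p))"
  and PP [simp]: "P p (P p u) = u" and gPP: "g p (P p u) (P p v) = g p u v"
  and trP: "trace (matrix (P p)) = 0"
  using RAP unfolding riemannian_almost_product_def tensor11_def by auto

lemmas P_simps [simp] = linear_add[OF P_linear] linear_diff[OF P_linear] linear_cmul[OF P_linear]
  linear_neg[OF P_linear] linear_0[OF P_linear]

lemma gP_sym: "g p (P p u) v = g p u (P p v)"
  using gPP[of p u "P p v"] by simp

lemma eig_orth: "P p u = s *\<^sub>R u \<Longrightarrow> P p v = (- s) *\<^sub>R v \<Longrightarrow> s = 1 \<or> s = - 1 \<Longrightarrow> g p u v = 0"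
  using gPP[of p u v] by auto

lemma vf_extension_at [simp]: "vf_extension A p v p = v"
  using someI_ex[OF smooth_extension[of p v]] unfolding vf_extension_def by auto

text \<open>Only the last argument of \<open>F\<close> carries the vector, and \<open>F\<close> depends on it through its value
  at \<open>p\<close>.\<close>

lemma lee_linear: "linear (lee p)"
  by (rule linearI)
    (simp_all add: lee_form_def F_at_def F_tensor_def distrib_left mult.left_commute sum.distrib
      sum_distrib_left del: g_simps(7))

lemmas lee_simps [simp] = linear_add[OF lee_linear] linear_diff[OF lee_linear] linear_cmul[OF lee_linear]
  linear_neg[OF lee_linear] linear_0[OF lee_linear]

text \<open>Nondegeneracy of \<open>g\<close> gives a unique dual vector, so that the description of \<open>\<Omega>\<close> by \<open>THE\<close>
  is meaningful.\<close>

lemma g_Omega [simp]: "g p (Omega p) v = lee p v"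
proof -
  define L where "L u = (\<chi> i. g p u (axis i 1))" for u
  have L: "linear L" by (rule linearI) (auto simp: L_def vec_eq_iff)
  have rep: "g p u v = (\<Sum>i\<in>UNIV. v $ i * g p u (axis i 1))" 
    "lee p v = (\<Sum>i\<in>UNIV. v $ i * lee p (axis i 1))" for u v
  proof -
    have v: "v = (\<Sum>i\<in>UNIV. v $ i *\<^sub>R axis i 1)"
      using basis_expansion[of v] by (simp add: scalar_mult_eq_scaleR)
    have l: "linear (g p u)" using g_bilin by (simp add: bilinear_def)
    show "g p u v = (\<Sum>i\<in>UNIV. v $ i * g p u (axis i 1))"
      by (subst v) (simp add: linear_sum[OF l] del: sum_component)
    show "lee p v = (\<Sum>i\<in>UNIV. v $ i * lee p (axis i 1))"
      by (subst v) (simp add: linear_sum[OF lee_linear] del: sum_component)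
  qed
  have "inj L"
  proof (rule injI)
    fix u v assume "L u = L v"
    then have "g p u (axis i 1) = g p v (axis i 1)" for i by (simp add: L_def vec_eq_iff)
    then show "u = v" by (intro g_eqI[of p]) (metis (no_types, lifting) rep(1) sum.cong)
  qed
  then obtain u where "L u = (\<chi> i. lee p (axis i 1))"
    using linear_injective_imp_surjective[OF L] by (metis surjD)
  then have "g p u (axis i 1) = lee p (axis i 1)" for i by (simp add: L_def vec_eq_iff)
  then have "\<forall>v. g p u v = lee p v" by (metis (no_types, lifting) rep sum.cong)
  moreover have "u' = u" if "\<forall>v. g p u' v = lee p v" for u'
    using that \<open>\<forall>v. g p u v = lee p v\<close> g_eqI by metis
  ultimately have "\<forall>v. g p (Omega p) v = lee p v"
    unfolding dual_vector_def by (rule theI)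
  then show ?thesis by blast
qed

text \<open>The formula for \<open>F\<close> that defines the class, freed of its last argument by nondegeneracy of
  \<open>g\<close>.\<close>

lemma nabla_P:
  assumes "sv X" "sv Y"
  shows "nabla X (\<lambda>q. P q (Y q)) p = P p (nabla X Y p)
    + k *\<^sub>R (g p (X p) (Y p) *\<^sub>R Omega p - g p (X p) (P p (Y p)) *\<^sub>R P p (Omega p)
      + lee p (Y p) *\<^sub>R X p - lee p (P p (Y p)) *\<^sub>R P p (X p))" (is "?l = ?r")
proof (rule g_eqI)
  fix w
  obtain Z where Z: "sv Z" "Z p = w" using smooth_extension by blast
  have "F_tensor P g nabla X Y Z p = k *
          (g p (X p) (Y p) * lee p (Z p) - g p (X p) (P p (Y p)) * lee p (P p (Z p))
         + g p (X p) (Z p) * lee p (Y p) - g p (X p) (P p (Z p)) * lee p (P p (Y p)))"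
    using W1 assms Z(1) unfolding W1_manifold_def Let_def by blast
  then show "g p ?l w = g p ?r w"
    by (simp add: F_tensor_def Z gP_sym algebra_simps)
qed

text \<open>Averaging any extension of an eigenvector with \<open>\<plusminus> P\<close> of it gives a field of eigenvectors.\<close>

lemma eig_field:
  assumes s: "s = 1 \<or> s = - 1" and f: "linear f"
  shows "\<exists>Z. sv Z \<and> (\<forall>q. P q (Z q) = s *\<^sub>R Z q) \<and> Z p \<noteq> 0 \<and> f (Z p) = (0::real)"
proof -
  obtain z where z: "z \<noteq> 0" "P p z = s *\<^sub>R z" "f z = 0"
    using involution_eigenvector[OF P_linear PP trP _ s f] dim by auto
  obtain Y where Y: "sv Y" "Y p = z" using smooth_extension by blast
  define Z where "Z q = (1/2) *\<^sub>R (Y q + s *\<^sub>R P q (Y q))" for q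
  have "sv Z" unfolding Z_def[abs_def] using Y by (intro sv_scale_const sv_add P_sv)
  moreover have "P q (Z q) = s *\<^sub>R Z q" for q
    using s by (auto simp: Z_def algebra_simps)
  moreover have "Z p = z"
    using s z Y by (auto simp: Z_def simp flip: scaleR_2)
  ultimately show ?thesis using z by blast
qed

text \<open>For a field \<open>Z\<close> with \<open>PZ = s Z\<close> the formula for \<open>\<nabla>P\<close> collapses to
  \<open>(\<nabla>\<^sub>Z P) Z = k g(Z,Z) (\<Omega> - s P\<Omega>)\<close>. The left-hand side is smooth, hence so are \<open>\<Omega> - P\<Omega>\<close> and
  \<open>\<Omega> + P\<Omega>\<close>.\<close>

lemma sv_Omega: "sv Omega"
proof -
  have 1: "sv (\<lambda>q. Omega q - s *\<^sub>R P q (Omega q))" if s: "s = 1 \<or> s = - 1" for s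
  proof (rule sv_divide)
    fix p
    obtain Z where Z: "sv Z" "\<And>q. P q (Z q) = s *\<^sub>R Z q" "Z p \<noteq> 0"
      using eig_field[OF s linear_zero] by blast
    let ?f = "\<lambda>q. k * g q (Z q) (Z q)"
    have "sv (\<lambda>q. nabla Z (\<lambda>q. P q (Z q)) q - P q (nabla Z Z q))"
      by (intro sv_diff conn_sv[OF nabla_conn] P_sv Z)
    moreover have "nabla Z (\<lambda>q. P q (Z q)) q - P q (nabla Z Z q)
        = ?f q *\<^sub>R (Omega q - s *\<^sub>R P q (Omega q))" for q
      unfolding nabla_P[OF Z(1,1)] using s by (auto simp: Z(2) algebra_simps)
    ultimately have "sv (\<lambda>q. ?f q *\<^sub>R (Omega q - s *\<^sub>R P q (Omega q)))" by simp
    moreover have "sf ?f" by (intro sf_mult sf_const sf_g Z)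
    moreover have "?f p \<noteq> 0" using g_pos[OF Z(3), of p] k_pos by simp
    ultimately show "\<exists>f. sf f \<and> f p \<noteq> 0 \<and> sv (\<lambda>q. f q *\<^sub>R (Omega q - s *\<^sub>R P q (Omega q)))" by blast
  qed
  have "sv (\<lambda>q. (1/2) *\<^sub>R ((Omega q - 1 *\<^sub>R P q (Omega q)) + (Omega q - (- 1) *\<^sub>R P q (Omega q))))"
    by (intro sv_scale_const sv_add 1) auto
  moreover have "(1/2) *\<^sub>R ((Omega q - 1 *\<^sub>R P q (Omega q)) + (Omega q - (- 1) *\<^sub>R P q (Omega q))) = Omega q" for q
    by (simp flip: scaleR_2)
  ultimately show ?thesis by simp
qed

lemma sf_lee [intro]: "sv X \<Longrightarrow> sf (\<lambda>q. lee q (X q))"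
  using sf_g[OF sv_Omega, of X] by simp

section \<open>The natural connections\<close>

text \<open>The torsion forms \<open>\<alpha>\<close>, \<open>\<beta>\<close> of the connection with parameters \<open>(\<lambda>, \<mu>)\<close>, and the vector
  fields dual to them. With these the four correction terms of the connection take the same
  shape in pairs.\<close>

definition "alpha lam mu p v = lam * lee p (P p v) + mu * lee p v"
definition "beta lam mu p v = lam * lee p v + (mu + k) * lee p (P p v)"
definition "alpha_vec lam mu p = lam *\<^sub>R P p (Omega p) + mu *\<^sub>R Omega p"
definition "beta_vec lam mu p = lam *\<^sub>R Omega p + (mu + k) *\<^sub>R P p (Omega p)"

abbreviation nat_conn where "nat_conn \<equiv> natural_connection A P g nabla n"

lemma nat_conn_eq: "nat_conn lam mu X Y p = nabla X Y p + g p (X p) (P p (Y p)) *\<^sub>R alpha_vec lam mu p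
    - alpha lam mu p (Y p) *\<^sub>R P p (X p) + g p (X p) (Y p) *\<^sub>R beta_vec lam mu p - beta lam mu p (Y p) *\<^sub>R X p"
  by (simp add: natural_connection_def Let_def alpha_def beta_def alpha_vec_def beta_vec_def)

lemma alpha_linear: "linear (alpha lam mu p)" and beta_linear: "linear (beta lam mu p)"
  by (auto intro!: linearI simp: alpha_def beta_def algebra_simps)

lemmas alpha_beta_simps [simp] = linear_add[OF alpha_linear] linear_diff[OF alpha_linear] linear_cmul[OF alpha_linear]
  linear_add[OF beta_linear] linear_diff[OF beta_linear] linear_cmul[OF beta_linear]

lemma sf_alpha [intro]: "sv X \<Longrightarrow> sf (\<lambda>q. alpha lam mu q (X q))"
  and sf_beta [intro]: "sv X \<Longrightarrow> sf (\<lambda>q. beta lam mu q (X q))"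
  unfolding alpha_def beta_def by (intro sf_add sf_mult sf_const sf_lee P_sv; simp)+

lemma sv_alpha_vec: "sv (alpha_vec lam mu)" and sv_beta_vec: "sv (beta_vec lam mu)"
  unfolding alpha_vec_def[abs_def] beta_vec_def[abs_def] by (intro sv_add sv_scale_const P_sv sv_Omega)+

lemma g_alpha_vec [simp]: "g p (alpha_vec lam mu p) v = alpha lam mu p v"
  and g_beta_vec [simp]: "g p (beta_vec lam mu p) v = beta lam mu p v"
  by (simp_all add: alpha_vec_def beta_vec_def alpha_def beta_def gP_sym)

lemma nat_conn_linear: "linear_connection A (nat_conn lam mu)"
proof -
  have 1: "sv (nat_conn lam mu X Y)" if "sv X" "sv Y" for X Y
  proof -
    have "sv (\<lambda>p. nabla X Y p + g p (X p) (P p (Y p)) *\<^sub>R alpha_vec lam mu p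
      - alpha lam mu p (Y p) *\<^sub>R P p (X p) + g p (X p) (Y p) *\<^sub>R beta_vec lam mu p - beta lam mu p (Y p) *\<^sub>R X p)"
      by (intro sv_add sv_diff sv_scale conn_sv[OF nabla_conn] sf_g sf_alpha sf_beta P_sv sv_alpha_vec sv_beta_vec that)
    then show ?thesis by (simp flip: nat_conn_eq)
  qed
  show ?thesis
    unfolding linear_connection_def
    using 1
    by (auto simp: nat_conn_eq fun_eq_iff conn_add1[OF nabla_conn] conn_add2[OF nabla_conn]
        conn_scale1[OF nabla_conn] conn_scale2[OF nabla_conn] algebra_simps)
qed

text \<open>The four correction terms were chosen to cancel \<open>\<nabla>P\<close>: the coefficients of \<open>\<lambda>\<close> and \<open>\<mu>\<close> drop
  out, and the summand \<open>k\<close> in \<open>\<beta>\<close> compensates the formula for \<open>\<nabla>P\<close>.\<close>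

lemma nat_conn_P:
  assumes "sv X" "sv Y"
  shows "nat_conn lam mu X (\<lambda>q. P q (Y q)) p = P p (nat_conn lam mu X Y p)"
  by (simp add: nat_conn_eq nabla_P[OF assms] alpha_def beta_def alpha_vec_def beta_vec_def algebra_simps)

text \<open>For fixed \<open>X\<close> the correction is the difference of two maps that are adjoint to each other,
  hence skew.\<close>

lemma nat_conn_metric:
  assumes "sv X" "sv Y" "sv Z"
  shows "vf_deriv A X (\<lambda>q. g q (Y q) (Z q)) p
    = g p (nat_conn lam mu X Y p) (Z p) + g p (Y p) (nat_conn lam mu X Z p)"
  using gP_sym[of p "X p"] g_sym[of p "Y p"]
  by (simp add: nabla_metric[OF assms] nat_conn_eq algebra_simps)

lemma nat_conn_torsion:
  assumes "sv X" "sv Y"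
  shows "nat_conn lam mu X Y p - nat_conn lam mu Y X p = bracket A X Y p
    + (alpha lam mu p (X p) *\<^sub>R P p (Y p) - alpha lam mu p (Y p) *\<^sub>R P p (X p)
       + beta lam mu p (X p) *\<^sub>R Y p - beta lam mu p (Y p) *\<^sub>R X p)"
  using gP_sym[of p "Y p" "X p"] g_sym[of p "Y p"] g_sym[of p "P p (Y p)"]
  by (simp add: bracket_eq[OF assms] nat_conn_eq algebra_simps)

abbreviation "curv lam mu \<equiv> curvature A (nat_conn lam mu)"
abbreviation "cyc lam mu X Y Z p \<equiv> curv lam mu X Y Z p + curv lam mu Y Z X p + curv lam mu Z X Y p"

lemma nat_conn_bianchi:
  assumes "sv X" "sv Y" "sv Z"
  shows "cyc lam mu X Y Z p
    = (ext_d A (alpha lam mu) X Y p *\<^sub>R P p (Z p) + ext_d A (beta lam mu) X Y p *\<^sub>R Z p)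
    + (ext_d A (alpha lam mu) Y Z p *\<^sub>R P p (X p) + ext_d A (beta lam mu) Y Z p *\<^sub>R X p)
    + (ext_d A (alpha lam mu) Z X p *\<^sub>R P p (Y p) + ext_d A (beta lam mu) Z X p *\<^sub>R Y p)"
  by (rule first_bianchi[OF nat_conn_linear P_linear P_sv nat_conn_P alpha_linear sf_alpha beta_linear sf_beta nat_conn_torsion])
    (auto simp: assms)

lemma curv_P:
  assumes "sv X" "sv Y" "sv Z"
  shows "curv lam mu X Y (\<lambda>q. P q (Z q)) p = P p (curv lam mu X Y Z p)"
proof -
  have 1: "nat_conn lam mu X (\<lambda>q. P q (Z q)) = (\<lambda>q. P q (nat_conn lam mu X Z q))" if "sv X" "sv Z" for X Z
    using nat_conn_P that by blast
  show ?thesis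
    using assms by (simp add: curvature_def 1 conn_sv[OF nat_conn_linear] sv_bracket)
qed

lemma curv_skew:
  "sv X \<Longrightarrow> sv Y \<Longrightarrow> sv Z \<Longrightarrow> sv W \<Longrightarrow>
    g p (curv lam mu X Y Z p) (W p) = - g p (Z p) (curv lam mu X Y W p)"
  by (rule curvature_skew[OF nat_conn_linear nat_conn_metric])

abbreviation leeP where "leeP \<equiv> \<lambda>p v. lee p (P p v)"

section \<open>Closedness of the two torsion forms\<close>

lemma ext_d_alpha:
  assumes "sv X" "sv Y"
  shows "ext_d A (alpha lam mu) X Y p = lam * ext_d A leeP X Y p + mu * ext_d A lee X Y p"
    and "ext_d A (beta lam mu) X Y p = lam * ext_d A lee X Y p + (mu + k) * ext_d A leeP X Y p"
proof -
  have v: "vf_deriv A X (\<lambda>q. a * lee q (P q (Y q)) + b * lee q (Y q)) p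
      = a * vf_deriv A X (\<lambda>q. lee q (P q (Y q))) p + b * vf_deriv A X (\<lambda>q. lee q (Y q)) p"
    if "sv Y" for X Y a b
    using that by (simp add: vf_deriv_add vf_deriv_cmult sf_mult sf_const sf_lee P_sv)
  show "ext_d A (alpha lam mu) X Y p = lam * ext_d A leeP X Y p + mu * ext_d A lee X Y p"
    unfolding ext_d_def alpha_def v[OF assms(1)] v[OF assms(2)] by (simp add: algebra_simps)
  have c: "beta lam mu p v = (mu + k) * lee p (P p v) + lam * lee p v" for p v
    by (simp add: beta_def)
  show "ext_d A (beta lam mu) X Y p = lam * ext_d A lee X Y p + (mu + k) * ext_d A leeP X Y p"
    unfolding ext_d_def c v[OF assms(1)] v[OF assms(2)] by (simp only: ring_distribs mult.assoc)
qed

lemma ext_d_anti: "ext_d A t X Y p = - ext_d A t Y X p" if "\<And>p. linear (t p)"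
  using linear_neg[OF that, of p] bracket_anti[of X Y p] by (simp add: ext_d_def)

lemma ext_d_add:
  assumes "\<And>p. linear (t p)" "\<And>X. sv X \<Longrightarrow> sf (\<lambda>q. t q (X q))" "sv X" "sv Y" "sv Z"
  shows "ext_d A t (\<lambda>q. X q + Y q) Z p = ext_d A t X Z p + ext_d A t Y Z p"
  using assms by (simp add: ext_d_def bracket_add vf_deriv_vec vf_deriv_add linear_add)

text \<open>Take \<open>Z\<close> in the other eigenspace and pair the cyclic sum with \<open>Z\<close>. The curvature terms
  with \<open>X\<close> or \<open>Y\<close> in third place stay in the eigenspace of \<open>X\<close> and \<open>Y\<close>, which is orthogonal to
  \<open>Z\<close>, and the remaining one vanishes by skewness.\<close>

lemma eig_same_relation:
  assumes s: "s = 1 \<or> s = - 1" and v: "sv X" "sv Y"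
    and X: "\<And>q. P q (X q) = s *\<^sub>R X q" and Y: "\<And>q. P q (Y q) = s *\<^sub>R Y q"
  shows "ext_d A (beta lam mu) X Y p = s * ext_d A (alpha lam mu) X Y p"
proof -
  obtain Z where Z: "sv Z" "\<And>q. P q (Z q) = (- s) *\<^sub>R Z q" "Z p \<noteq> 0"
    using eig_field[OF _ linear_zero, of "- s" p] s by auto
  have R: "P p (curv lam mu U V W p) = r *\<^sub>R curv lam mu U V W p"
    if v: "sv U" "sv V" "sv W" and W: "\<And>q. P q (W q) = r *\<^sub>R W q" for U V W r
  proof -
    have "P p (curv lam mu U V W p) = curv lam mu U V (\<lambda>q. r *\<^sub>R W q) p"
      using curv_P[OF v, symmetric] W by simp
    then show ?thesis using curvature_scale(2)[OF nat_conn_linear v sf_const] by simp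
  qed
  have o: "g p (X p) (Z p) = 0" "g p (Y p) (Z p) = 0"
    "g p (curv lam mu Y Z X p) (Z p) = 0" "g p (curv lam mu Z X Y p) (Z p) = 0"
    by (rule eig_orth[where s = s]; use s X Y Z R v in simp)+
  have "g p (curv lam mu X Y Z p) (Z p) = 0"
    using curv_skew[OF v Z(1,1), of p lam mu] g_sym[of p "Z p"] by simp
  then have "0 = g p (cyc lam mu X Y Z p) (Z p)" using o by simp
  also have "\<dots> = (ext_d A (beta lam mu) X Y p - s * ext_d A (alpha lam mu) X Y p) * g p (Z p) (Z p)"
    unfolding nat_conn_bianchi[OF v Z(1)] by (simp add: o X Y Z(2) algebra_simps)
  finally show ?thesis using g_pos[OF Z(3), of p] by simp
qed

text \<open>The previous relation for the parameters \<open>(0, -k)\<close>, where \<open>\<alpha> = - k \<theta>\<close> and \<open>\<beta> = 0\<close>, and for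
  \<open>(0, 0)\<close>, where \<open>\<alpha> = 0\<close> and \<open>\<beta> = k (\<theta> \<circ> P)\<close>. Two connections are needed because each gives one
  equation for the two unknowns.\<close>

lemma eig_same_closed:
  assumes s: "s = 1 \<or> s = - 1" and v: "sv X" "sv Y"
    and X: "\<And>q. P q (X q) = s *\<^sub>R X q" and Y: "\<And>q. P q (Y q) = s *\<^sub>R Y q"
  shows "ext_d A lee X Y p = 0" "ext_d A leeP X Y p = 0"
proof -
  note r = eig_same_relation[OF s v X Y, of _ _ p, unfolded ext_d_alpha[OF v]]
  show "ext_d A lee X Y p = 0" using r[of 0 "- k"] s k_pos by auto
  show "ext_d A leeP X Y p = 0" using r[of 0 0] k_pos by simp
qed

text \<open>Take \<open>Z\<close> in the eigenspace of \<open>X\<close> and orthogonal to \<open>X\<close>, which is possible because this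
  eigenspace has dimension at least two. Pairing the cyclic sum with \<open>Z\<close> keeps only the terms
  with \<open>Z\<close> in third place.\<close>

lemma eig_mixed_relation:
  assumes s: "s = 1 \<or> s = - 1" and v: "sv X" "sv Y"
    and X: "\<And>q. P q (X q) = s *\<^sub>R X q" and Y: "\<And>q. P q (Y q) = (- s) *\<^sub>R Y q"
    and S0: "\<And>Z. sv Z \<Longrightarrow> cyc lam mu X Y Z p = 0"
  shows "ext_d A (beta lam mu) X Y p = - s * ext_d A (alpha lam mu) X Y p"
proof -
  have "linear (g p (X p))" using g_bilin by (simp add: bilinear_def)
  then obtain Z where Z: "sv Z" "\<And>q. P q (Z q) = s *\<^sub>R Z q" "Z p \<noteq> 0" "g p (X p) (Z p) = 0"
    using eig_field[OF s] by blast
  have o: "g p (Y p) (Z p) = 0"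
    by (rule eig_orth[where s = "- s"]) (use s Y Z in auto)
  have "0 = g p (cyc lam mu X Y Z p) (Z p)" using S0[OF Z(1)] by simp
  also have "\<dots> = (ext_d A (beta lam mu) X Y p + s * ext_d A (alpha lam mu) X Y p) * g p (Z p) (Z p)"
    unfolding nat_conn_bianchi[OF v Z(1)] by (simp add: o X Y Z(2,4) algebra_simps)
  finally show ?thesis using g_pos[OF Z(3), of p] by simp
qed

text \<open>Every field is the sum of the eigenfields \<open>(X + PX) / 2\<close> and \<open>(X - PX) / 2\<close>, and the
  exterior derivative is additive.\<close>

lemma closed_from_mixed:
  assumes t: "\<And>p. linear (t p)" "\<And>X. sv X \<Longrightarrow> sf (\<lambda>q. t q (X q))"
    and same: "\<And>s X Y p. s = 1 \<or> s = - 1 \<Longrightarrow> sv X \<Longrightarrow> sv Y \<Longrightarrow> (\<And>q. P q (X q) = s *\<^sub>R X q) \<Longrightarrow>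
      (\<And>q. P q (Y q) = s *\<^sub>R Y q) \<Longrightarrow> ext_d A t X Y p = 0"
    and mixed: "\<And>X Y p. sv X \<Longrightarrow> sv Y \<Longrightarrow> (\<And>q. P q (X q) = X q) \<Longrightarrow>
      (\<And>q. P q (Y q) = - Y q) \<Longrightarrow> ext_d A t X Y p = 0"
  shows "closed_form A t"
  unfolding closed_form_iff
proof (intro allI impI)
  fix X Y p assume v: "sv X" "sv Y"
  let ?p = "\<lambda>X q. (1/2) *\<^sub>R (X q + P q (X q))" and ?m = "\<lambda>X q. (1/2) *\<^sub>R (X q - P q (X q))"
  have sv: "sv (?p X)" "sv (?m X)" if "sv X" for X
    using that by (intro sv_scale_const sv_add sv_diff P_sv; simp)+
  have P: "P q (?p X q) = ?p X q" "P q (?m X q) = - ?m X q" for X q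
    by (simp_all add: algebra_simps)
  have dec: "ext_d A t X Y p = ext_d A t (?p X) Y p + ext_d A t (?m X) Y p" if "sv X" "sv Y" for X Y
  proof -
    have "X = (\<lambda>q. ?p X q + ?m X q)"
      by (rule ext) (simp add: algebra_simps flip: scaleR_2 scaleR_add_left)
    then show ?thesis using ext_d_add[OF t sv[OF that(1)] that(2), of p] by simp
  qed
  have dec2: "ext_d A t X Y p = ext_d A t X (?p Y) p + ext_d A t X (?m Y) p" if "sv X" "sv Y" for X Y
    using dec[OF that(2,1)] ext_d_anti[of t X _ p, OF t(1)] by simp
  have "ext_d A t X Y p = ext_d A t (?p X) (?p Y) p + ext_d A t (?p X) (?m Y) p
      + (ext_d A t (?m X) (?p Y) p + ext_d A t (?m X) (?m Y) p)"
    using dec[OF v] dec2[OF sv(1)[OF v(1)] v(2)] dec2[OF sv(2)[OF v(1)] v(2)] by simp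
  moreover have "ext_d A t (?p X) (?p Y) p = 0"
    by (rule same[of 1]) (use sv v P in auto)
  moreover have "ext_d A t (?m X) (?m Y) p = 0"
    by (rule same[of "- 1"]) (use sv v P in auto)
  moreover have "ext_d A t (?p X) (?m Y) p = 0" "ext_d A t (?p Y) (?m X) p = 0"
    by (rule mixed[OF sv(1)[OF v(1)] sv(2)[OF v(2)]] mixed[OF sv(1)[OF v(2)] sv(2)[OF v(1)]];
        rule P)+
  ultimately show "ext_d A t X Y p = 0"
    using ext_d_anti[of t "?m X" "?p Y" p, OF t(1)] by simp
qed

text \<open>The first Bianchi identity is the only property of a Riemannian \<open>P\<close>-tensor that can fail.
  It follows from closed torsion forms at once; conversely the mixed relation, used for \<open>(X, Y)\<close>
  and for \<open>(Y, X)\<close>, gives both signs.\<close>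

lemma P_tensor_iff:
  "riemannian_P_tensor A P (curvature04 A g (nat_conn lam mu))
    \<longleftrightarrow> closed_form A (alpha lam mu) \<and> closed_form A (beta lam mu)" (is "?L \<longleftrightarrow> ?C")
proof
  assume ?L
  have S0: "cyc lam mu X Y Z p = 0" if "sv X" "sv Y" "sv Z" for X Y Z p
  proof (rule g_eqI[of p])
    fix w
    obtain W where W: "sv W" "W p = w" using smooth_extension by blast
    have "g p (curv lam mu X Y Z p) (W p) + g p (curv lam mu Y Z X p) (W p) + g p (curv lam mu Z X Y p) (W p) = 0"
      using \<open>?L\<close> that W(1) unfolding riemannian_P_tensor_def curvature04_def by blast
    then show "g p (cyc lam mu X Y Z p) w = g p 0 w" using W by simp
  qed
  have mixed: "ext_d A (alpha lam mu) X Y p = 0" "ext_d A (beta lam mu) X Y p = 0"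
    if v: "sv X" "sv Y" and X: "\<And>q. P q (X q) = X q" and Y: "\<And>q. P q (Y q) = - Y q" for X Y p
    using eig_mixed_relation[of 1 X Y lam mu p] eig_mixed_relation[of "- 1" Y X lam mu p] v X Y S0
      ext_d_anti[of "alpha lam mu" X Y p, OF alpha_linear] ext_d_anti[of "beta lam mu" X Y p, OF beta_linear] by simp_all
  have same: "ext_d A (alpha lam mu) X Y p = 0" "ext_d A (beta lam mu) X Y p = 0"
    if "s = 1 \<or> s = - 1" "sv X" "sv Y" "\<And>q. P q (X q) = s *\<^sub>R X q" "\<And>q. P q (Y q) = s *\<^sub>R Y q"
    for s X Y p
    using eig_same_closed[OF that] by (simp_all add: ext_d_alpha that(2,3))
  show ?C
    by (intro conjI; rule closed_from_mixed;
        (rule alpha_linear beta_linear | erule sf_alpha sf_beta | (rule same mixed; assumption)))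
next
  assume C: ?C
  have S0: "cyc lam mu X Y Z p = 0" if "sv X" "sv Y" "sv Z" for X Y Z p
    using C that by (simp add: nat_conn_bianchi closed_form_iff)
  have S1: "g p (curv lam mu X Y Z p) w + g p (curv lam mu Y Z X p) w + g p (curv lam mu Z X Y p) w = 0"
    if "sv X" "sv Y" "sv Z" for X Y Z p w
  proof -
    have "g p (cyc lam mu X Y Z p) w = 0" by (simp only: S0[OF that] g_simps)
    then show ?thesis by simp
  qed
  show ?L
    unfolding riemannian_P_tensor_def
  proof (intro conjI allI impI curvature_tensor04 nat_conn_linear)
    fix X Y Z W p
    assume v: "sv X" "sv Y" "sv Z" "sv W"
    let ?L = "curvature04 A g (nat_conn lam mu)"
    show "?L X Y Z W p = - ?L Y X Z W p"
      using curvature_anti[OF nat_conn_linear v(1-3), of lam mu p] by (simp add: curvature04_def)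
    show "?L X Y Z W p = - ?L X Y W Z p"
      using curv_skew[OF v, of p lam mu] g_sym[of p "Z p"] by (simp add: curvature04_def)
    show "?L X Y Z W p + ?L Y Z X W p + ?L Z X Y W p = 0"
      unfolding curvature04_def by (rule S1[OF v(1-3)])
    show "?L X Y (\<lambda>q. P q (Z q)) (\<lambda>q. P q (W q)) p = ?L X Y Z W p"
      by (simp add: curvature04_def curv_P[OF v(1-3)] gPP)
  qed
qed

lemma closed_alpha_beta:
  "closed_form A (alpha lam mu) \<longleftrightarrow> (\<forall>X Y p. sv X \<longrightarrow> sv Y \<longrightarrow>
      lam * ext_d A leeP X Y p + mu * ext_d A lee X Y p = 0)"
  "closed_form A (beta lam mu) \<longleftrightarrow> (\<forall>X Y p. sv X \<longrightarrow> sv Y \<longrightarrow>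
      lam * ext_d A lee X Y p + (mu + k) * ext_d A leeP X Y p = 0)"
  by (simp_all add: closed_form_iff ext_d_alpha)

end


section \<open>Classification of the curvature condition\<close>

theorem theorem4p3:
  fixes A :: "('m::{t2_space,second_countable_topology}, 'n::finite) chart set"
    and P :: "'m \<Rightarrow> real ^ 'n \<Rightarrow> real ^ 'n"
    and g :: "'m \<Rightarrow> real ^ 'n \<Rightarrow> real ^ 'n \<Rightarrow> real"
    and nabla :: "('m, 'n) connection"
    and n :: nat
    and lam mu :: real
    and \<theta> \<theta>P :: "'m \<Rightarrow> real ^ 'n \<Rightarrow> real"
    and R' :: "('m, 'n) form4"
  assumes dimM: "CARD('n) = 2 * n" "n \<ge> 2"
    and MPg: "riemannian_almost_product A P g"
    and LC: "levi_civita A g nabla"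
    and W1: "W1_manifold A P g nabla n"
    and \<theta>: "\<theta> = lee_form A P g nabla"
    and \<theta>P: "\<theta>P = (\<lambda>p v. \<theta> p (P p v))"
    and R': "R' = curvature04 A g (natural_connection A P g nabla n lam mu)"
  shows
    "(lam = 0 \<and> mu = 0 \<longrightarrow>
        \<not> (closed_form A \<theta> \<and> closed_form A \<theta>P) \<longrightarrow>
        (riemannian_P_tensor A P R' \<longleftrightarrow> \<not> closed_form A \<theta> \<and> closed_form A \<theta>P)) \<and>
     (lam = 0 \<and> mu = - 1 / (2 * real n) \<longrightarrow>
        \<not> (closed_form A \<theta> \<and> closed_form A \<theta>P) \<longrightarrow>
        (riemannian_P_tensor A P R' \<longleftrightarrow> closed_form A \<theta> \<and> \<not> closed_form A \<theta>P)) \<and>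
     (lam^2 - mu^2 - mu / (2 * real n) \<noteq> 0 \<longrightarrow>
        (riemannian_P_tensor A P R' \<longleftrightarrow> closed_form A \<theta> \<and> closed_form A \<theta>P)) \<and>
     (lam \<noteq> 0 \<and> lam^2 - mu^2 - mu / (2 * real n) = 0 \<and> riemannian_P_tensor A P R' \<longrightarrow>
        \<not> (closed_form A \<theta> \<and> closed_form A \<theta>P) \<longrightarrow>
        \<not> closed_form A \<theta> \<and> \<not> closed_form A \<theta>P \<and>
        \<not> W3_bar A P g nabla n \<and> \<not> W6_bar A P g nabla n)"
proof -
  interpret smooth_mfd A
    using MPg by unfold_locales (simp add: riemannian_almost_product_def)
  interpret w1_mfd A g nabla P n
    using MPg LC W1 dimM by unfold_locales (simp_all add: riemannian_almost_product_def)
  let ?d = "ext_d A lee" and ?e = "ext_d A leeP"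
  have RP: "riemannian_P_tensor A P R' \<longleftrightarrow> (\<forall>X Y p. sv X \<longrightarrow> sv Y \<longrightarrow>
      lam * ?e X Y p + mu * ?d X Y p = 0 \<and> lam * ?d X Y p + (mu + k) * ?e X Y p = 0)"
    unfolding R' P_tensor_iff closed_alpha_beta by blast
  have c: "closed_form A \<theta> \<longleftrightarrow> (\<forall>X Y p. sv X \<longrightarrow> sv Y \<longrightarrow> ?d X Y p = 0)"
    "closed_form A \<theta>P \<longleftrightarrow> (\<forall>X Y p. sv X \<longrightarrow> sv Y \<longrightarrow> ?e X Y p = 0)"
    by (simp_all add: \<theta> \<theta>P closed_form_iff)
  have k: "k \<noteq> 0" using k_pos by simp
  \<comment> \<open>For \<open>\<lambda> = 0\<close> and \<open>\<mu> \<in> {0, -k}\<close> one row of the system vanishes and the other is a multiple of one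
    unknown.\<close>
  have 1: "riemannian_P_tensor A P R' \<longleftrightarrow> closed_form A \<theta>P" if "lam = 0" "mu = 0"
    unfolding RP c using that k by simp
  have 2: "riemannian_P_tensor A P R' \<longleftrightarrow> closed_form A \<theta>" if "lam = 0" "mu = - 1 / (2 * real n)"
    unfolding RP c using that k by simp
  have 3: "riemannian_P_tensor A P R' \<longleftrightarrow> closed_form A \<theta> \<and> closed_form A \<theta>P"
    if nz: "lam^2 - mu^2 - mu / (2 * real n) \<noteq> 0"
  proof -
    have det: "lam * lam - mu * (mu + k) \<noteq> 0"
      using nz by (simp add: power2_eq_square algebra_simps)
    have "x = 0 \<and> y = 0" if "lam * y + mu * x = 0" "lam * x + (mu + k) * y = 0" for x y
    proof -
      \<comment> \<open>Cramer's rule.\<close>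
      have "(lam * lam - mu * (mu + k)) * x
          = lam * (lam * x + (mu + k) * y) - (mu + k) * (lam * y + mu * x)"
        by algebra
      also have "\<dots> = 0" unfolding that by simp
      finally have x: "x = 0" using det by simp
      have "(lam * lam - mu * (mu + k)) * y
          = lam * (lam * y + mu * x) - mu * (lam * x + (mu + k) * y)"
        by algebra
      also have "\<dots> = 0" unfolding that by simp
      finally show ?thesis using x det by simp
    qed
    then have "lam * y + mu * x = 0 \<and> lam * x + (mu + k) * y = 0 \<longleftrightarrow> x = 0 \<and> y = 0" for x y
      by (metis add_0 mult_zero_right)
    then have "riemannian_P_tensor A P R' \<longleftrightarrow>
        (\<forall>X Y p. sv X \<longrightarrow> sv Y \<longrightarrow> ?e X Y p = 0 \<and> ?d X Y p = 0)"
      unfolding RP by (simp only: conj_commute)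
    then show ?thesis unfolding c by (simp only: imp_conjR all_conj_distrib conj_commute)
  qed
  have 4: "\<not> closed_form A \<theta> \<and> \<not> closed_form A \<theta>P \<and>
        \<not> W3_bar A P g nabla n \<and> \<not> W6_bar A P g nabla n"
    if lam: "lam \<noteq> 0" and T: "riemannian_P_tensor A P R'"
      and nc: "\<not> (closed_form A \<theta> \<and> closed_form A \<theta>P)"
  proof -
    note r = T[unfolded RP, rule_format]
    have a: "?d X Y p = 0 \<longleftrightarrow> ?e X Y p = 0" if "sv X" "sv Y" for X Y p
      using r[OF that, of p] lam by auto
    \<comment> \<open>On both subclasses the system has proportional unknowns, \<open>d(\<theta> \<circ> P) = s d\<theta>\<close>, and the second
      row minus \<open>s\<close> times the first is \<open>k s d\<theta> = 0\<close>.\<close>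
    have "False" if s: "s = 1 \<or> s = - 1" and P: "\<And>p v. lee p (P p v) = s * lee p v" for s
    proof -
      have e: "?e X Y p = s * ?d X Y p" if "sv X" "sv Y" for X Y p
        using that by (simp add: ext_d_def P vf_deriv_cmult sf_lee algebra_simps)
      have "?d X Y p = 0" if v: "sv X" "sv Y" for X Y p
      proof -
        have ss: "s * s = 1" using s by auto
        have "k * s * ?d X Y p
            = (lam * ?d X Y p + (mu + k) * ?e X Y p) - s * (lam * ?e X Y p + mu * ?d X Y p)"
          unfolding e[OF v] using ss by algebra
        also have "\<dots> = 0" using r[OF v, of p] by simp
        finally show ?thesis using k s by auto
      qed
      with a nc show False unfolding c by blast
    qed
    from this[of "- 1"] this[of 1] show ?thesis
      using a nc unfolding c W3_bar_def W6_bar_def Let_def by auto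
  qed
  show ?thesis using 1 2 3 4 by blast
qed

end
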